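(* Let $\mathcal{C}$ be a class of graphs that is of bounded expansion. Then for each positive integer $k$ there is a constant $c_k = c(k,\mathcal{C})$ (depending only on $k$ and $\mathcal{C}$) such that for each $G \in \mathcal{C}$ we have $f_k(G) \leq c_k$.
   Context: All graphs are simple, finite and undirected. An induced forest in $G$ is an acyclic induced subgraph of $G$. For $k\geq 1$, a $k$-strong forest of $G$ is an induced forest in $G$ each of whose connected components has at least $k$ edges. An edge of $G$ is $k$-valid if it is contained in some $k$-strong forest of $G$. The $k$-strong induced arboricity $f_k(G)$ is the smallest number of $k$-strong forests of $G$ that together cover all $k$-valid edges of $G$ (so $f_k(G)=0$ if $G$ has no $k$-valid edges). Shallow minors: for a graph $H$ and an integer $d\geq 0$, a graph $G$ with vertex set $\{v_1,\ldots,v_n\}$ is a $d$-shallow minor of $H$ if there are pairwise disjoint vertex subsets $B_1,\ldots,B_n$ of $H$ such that each $B_i$ induces a connected subgraph of $H$ of radius at most $d$ (some vertex is within distance $d$ of all others), and for each edge $v_iv_j$ of $G$ there is an edge of $H$ with one endpoint in $B_i$ and the other in $B_j$. A class $\mathcal{C}$ of graphs is of bounded expansion if for every integer $d\geq 0$ there is a constant $a_d=a(d,\mathcal{C})$ such that every $d$-shallow minor $G$ of a graph in $\mathcal{C}$ satisfies $|E(G)|\leq a_d|V(G)|$. *)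

theory Defs
  imports Complex_Main "HOL-Library.Extended_Nat"
begin

text \<open>A graph is a pair of a vertex set and a set of edges, an edge being a two-element set of
  vertices. The well-formedness condition \<open>simple_graph\<close> (finite, simple, undirected) is an explicit
  hypothesis wherever it is needed.\<close>

type_synonym 'a ugraph = "'a set \<times> 'a set set"

abbreviation verts :: "'a ugraph \<Rightarrow> 'a set" where
  "verts \<equiv> fst"

abbreviation edges :: "'a ugraph \<Rightarrow> 'a set set" where
  "edges \<equiv> snd"

definition simple_graph :: "'a ugraph \<Rightarrow> bool" where
  "simple_graph G \<longleftrightarrow>
     finite (verts G) \<and> (\<forall>e\<in>edges G. \<exists>u\<in>verts G. \<exists>v\<in>verts G. u \<noteq> v \<and> e = {u, v})"

definition adj :: "'a ugraph \<Rightarrow> 'a \<Rightarrow> 'a \<Rightarrow> bool" where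
  "adj G u v \<longleftrightarrow> {u, v} \<in> edges G"

definition induce :: "'a ugraph \<Rightarrow> 'a set \<Rightarrow> 'a ugraph" where
  "induce G S = (S, {e \<in> edges G. e \<subseteq> S})"

definition induced_subgraph :: "'a ugraph \<Rightarrow> 'a ugraph \<Rightarrow> bool" where
  "induced_subgraph F G \<longleftrightarrow> (\<exists>S \<subseteq> verts G. F = induce G S)"

definition walk :: "'a ugraph \<Rightarrow> 'a \<Rightarrow> 'a list \<Rightarrow> 'a \<Rightarrow> bool" where
  "walk G u p v \<longleftrightarrow>
     p \<noteq> [] \<and> hd p = u \<and> last p = v \<and> set p \<subseteq> verts G \<and> successively (adj G) p"

definition reachable :: "'a ugraph \<Rightarrow> 'a \<Rightarrow> 'a \<Rightarrow> bool" where
  "reachable G u v \<longleftrightarrow> (\<exists>p. walk G u p v)"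

definition connected_graph :: "'a ugraph \<Rightarrow> bool" where
  "connected_graph G \<longleftrightarrow> verts G \<noteq> {} \<and> (\<forall>u\<in>verts G. \<forall>v\<in>verts G. reachable G u v)"

definition components :: "'a ugraph \<Rightarrow> 'a ugraph set" where
  "components G = (\<lambda>u. induce G {v \<in> verts G. reachable G u v}) ` verts G"

text \<open>A cycle is given by its cyclic vertex sequence. The bound on the length excludes going
  back and forth along a single edge.\<close>

definition cycle :: "'a ugraph \<Rightarrow> 'a list \<Rightarrow> bool" where
  "cycle G p \<longleftrightarrow> length p \<ge> 3 \<and> distinct p \<and> walk G (hd p) p (last p) \<and> adj G (last p) (hd p)"

definition acyclic_graph :: "'a ugraph \<Rightarrow> bool" where
  "acyclic_graph G \<longleftrightarrow> (\<nexists>p. cycle G p)"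

definition induced_forest :: "'a ugraph \<Rightarrow> 'a ugraph \<Rightarrow> bool" where
  "induced_forest G F \<longleftrightarrow> induced_subgraph F G \<and> acyclic_graph F"

definition strong_forest :: "nat \<Rightarrow> 'a ugraph \<Rightarrow> 'a ugraph \<Rightarrow> bool" where
  "strong_forest k G F \<longleftrightarrow> induced_forest G F \<and> (\<forall>K\<in>components F. k \<le> card (edges K))"

definition valid_edge :: "nat \<Rightarrow> 'a ugraph \<Rightarrow> 'a set \<Rightarrow> bool" where
  "valid_edge k G e \<longleftrightarrow> e \<in> edges G \<and> (\<exists>F. strong_forest k G F \<and> e \<in> edges F)"

definition strong_cover :: "nat \<Rightarrow> 'a ugraph \<Rightarrow> 'a ugraph set \<Rightarrow> bool" where
  "strong_cover k G \<F> \<longleftrightarrow>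
     finite \<F> \<and> (\<forall>F\<in>\<F>. strong_forest k G F) \<and> {e. valid_edge k G e} \<subseteq> \<Union> (edges ` \<F>)"

definition strong_arboricity :: "nat \<Rightarrow> 'a ugraph \<Rightarrow> nat" where
  "strong_arboricity k G = (LEAST n. \<exists>\<F>. strong_cover k G \<F> \<and> card \<F> = n)"

text \<open>The least number above is always attained.\<close>

lemma simple_graph_finite_edges:
  assumes "simple_graph G"
  shows "finite (edges G)"
proof (rule finite_subset)
  show "edges G \<subseteq> Pow (verts G)"
  proof
    fix e assume "e \<in> edges G"
    with assms obtain u v where "u \<in> verts G" "v \<in> verts G" "e = {u, v}"
      unfolding simple_graph_def by meson
    then show "e \<in> Pow (verts G)" by simp
  qed
  show "finite (Pow (verts G))"
    using assms by (simp add: simple_graph_def)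
qed

lemma strong_arboricity_attained:
  assumes "simple_graph G"
  shows "\<exists>\<F>. strong_cover k G \<F> \<and> card \<F> = strong_arboricity k G"
proof -
  let ?\<F> = "{F. strong_forest k G F}"
  have "?\<F> \<subseteq> induce G ` Pow (verts G)"
  proof
    fix F assume "F \<in> ?\<F>"
    then have "\<exists>S \<subseteq> verts G. F = induce G S"
      by (simp add: strong_forest_def induced_forest_def induced_subgraph_def)
    then obtain S where "S \<subseteq> verts G" "F = induce G S" by (elim exE conjE)
    then show "F \<in> induce G ` Pow (verts G)" by simp
  qed
  then have "finite ?\<F>"
    by (rule finite_subset) (use assms in \<open>simp add: simple_graph_def\<close>)
  then have "strong_cover k G ?\<F>"
    by (simp add: strong_cover_def valid_edge_def subset_iff)
  then have "\<exists>n \<F>. strong_cover k G \<F> \<and> card \<F> = n"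
    by (intro exI[of _ "card ?\<F>"] exI[of _ ?\<F>] conjI refl)
  then show ?thesis
    unfolding strong_arboricity_def
    by (rule LeastI_ex[of "\<lambda>n. \<exists>\<F>. strong_cover k G \<F> \<and> card \<F> = n"])
qed

lemma strong_arboricity_eq_0:
  assumes "\<And>e. \<not> valid_edge k G e"
  shows "strong_arboricity k G = 0"
proof -
  have "strong_cover k G {}"
    using assms by (simp add: strong_cover_def)
  then have "\<exists>\<F>. strong_cover k G \<F> \<and> card \<F> = 0"
    by (intro exI[of _ "{}"]) simp
  then show ?thesis
    unfolding strong_arboricity_def
    by (rule Least_eq_0[of "\<lambda>n. \<exists>\<F>. strong_cover k G \<F> \<and> card \<F> = n"])
qed

text \<open>Distance is infinite between vertices that are not joined by a walk.\<close>

definition graph_dist :: "'a ugraph \<Rightarrow> 'a \<Rightarrow> 'a \<Rightarrow> enat" where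
  "graph_dist G u v = (INF p\<in>{p. walk G u p v}. enat (length p - 1))"

definition radius_at_most :: "'a ugraph \<Rightarrow> nat \<Rightarrow> bool" where
  "radius_at_most G d \<longleftrightarrow> (\<exists>c\<in>verts G. \<forall>v\<in>verts G. graph_dist G c v \<le> enat d)"

definition shallow_minor :: "nat \<Rightarrow> 'b ugraph \<Rightarrow> 'a ugraph \<Rightarrow> bool" where
  "shallow_minor d G H \<longleftrightarrow>
     (\<exists>B :: 'b \<Rightarrow> 'a set.
        (\<forall>v\<in>verts G. B v \<subseteq> verts H \<and> connected_graph (induce H (B v))
                       \<and> radius_at_most (induce H (B v)) d) \<and>
        (\<forall>u\<in>verts G. \<forall>v\<in>verts G. u \<noteq> v \<longrightarrow> B u \<inter> B v = {}) \<and>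
        (\<forall>u\<in>verts G. \<forall>v\<in>verts G. adj G u v \<longrightarrow> (\<exists>x\<in>B u. \<exists>y\<in>B v. adj H x y)))"

text \<open>The definition must fix a vertex type for the minors. Every finite graph has an isomorphic copy
  on natural numbers, so \<open>nat\<close> is general enough; see \<open>bounded_expansion_any_type\<close> below.\<close>

definition bounded_expansion :: "'a ugraph set \<Rightarrow> bool" where
  "bounded_expansion \<C> \<longleftrightarrow>
     (\<forall>d. \<exists>a :: real. \<forall>H\<in>\<C>. \<forall>G :: nat ugraph.
        simple_graph G \<and> shallow_minor d G H \<longrightarrow>
        real (card (edges G)) \<le> a * real (card (verts G)))"

lemma bounded_expansion_any_type:
  fixes \<C> :: "'a ugraph set"
  assumes "bounded_expansion \<C>"
  shows "\<exists>a :: real. \<forall>H\<in>\<C>. \<forall>G :: 'b ugraph. simple_graph G \<and> shallow_minor d G H \<longrightarrow>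
           real (card (edges G)) \<le> a * real (card (verts G))"
proof -
  obtain a :: real where a: "\<And>H G. \<lbrakk>H \<in> \<C>; simple_graph (G :: nat ugraph); shallow_minor d G H\<rbrakk> \<Longrightarrow>
      real (card (edges G)) \<le> a * real (card (verts G))"
    using assms[unfolded bounded_expansion_def, THEN spec, of d] by blast
  have "real (card (edges G)) \<le> a * real (card (verts G))"
    if H: "H \<in> \<C>" and G: "simple_graph G" and minor: "shallow_minor d G H"
    for H and G :: "'b ugraph"
  proof -
    obtain V E where VE: "G = (V, E)" by (rule prod.exhaust)
    have fin: "finite V"
      and E: "\<And>e. e \<in> E \<Longrightarrow> \<exists>u\<in>V. \<exists>v\<in>V. u \<noteq> v \<and> e = {u, v}"
      using G VE by (simp_all add: simple_graph_def)
    have EV: "E \<subseteq> Pow V" using E by blast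
    obtain f :: "'b \<Rightarrow> nat" where f: "inj_on f V"
      using finite_imp_inj_to_nat_seg[OF fin] by blast
    let ?g = "inv_into V f"
    let ?G = "(f ` V, (`) f ` E)"
    have injE: "inj_on ((`) f) E"
      using inj_on_subset[OF inj_on_image_Pow[OF f] EV] .
    have simple: "simple_graph ?G"
      unfolding simple_graph_def
    proof (intro conjI ballI)
      show "finite (verts ?G)" using fin by simp
    next
      fix e assume "e \<in> edges ?G"
      then obtain e' where e': "e' \<in> E" "e = f ` e'" by auto
      obtain u v where uv: "u \<in> V" "v \<in> V" "u \<noteq> v" "e' = {u, v}"
        using E[OF e'(1)] by blast
      then have "f u \<noteq> f v" using f by (simp add: inj_on_eq_iff)
      then show "\<exists>u\<in>verts ?G. \<exists>v\<in>verts ?G. u \<noteq> v \<and> e = {u, v}"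
        using uv unfolding e'(2) by auto
    qed
    obtain B where B1: "\<forall>v\<in>V. B v \<subseteq> verts H \<and> connected_graph (induce H (B v))
          \<and> radius_at_most (induce H (B v)) d"
      and B2: "\<forall>u\<in>V. \<forall>v\<in>V. u \<noteq> v \<longrightarrow> B u \<inter> B v = {}"
      and B3: "\<forall>u\<in>V. \<forall>v\<in>V. adj (V, E) u v \<longrightarrow> (\<exists>x\<in>B u. \<exists>y\<in>B v. adj H x y)"
      using minor unfolding shallow_minor_def VE fst_conv by (elim exE conjE) (rule that)
    have adj: "adj G u v" if "adj ?G (f u) (f v)" "u \<in> V" "v \<in> V" for u v
    proof -
      have "{f u, f v} \<in> (`) f ` E" using that(1) by (simp add: adj_def)
      then obtain e where e: "{f u, f v} = f ` e" "e \<in> E" by (rule imageE)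
      from e(1) have im: "f ` {u, v} = f ` e" by simp
      have "{u, v} \<subseteq> V" "e \<subseteq> V" using that e(2) EV by auto
      then have "{u, v} = e" using inj_on_image_eq_iff[OF f, of "{u, v}" e] im by simp
      then show ?thesis using e(2) VE by (simp add: adj_def)
    qed
    have "shallow_minor d ?G H"
      unfolding shallow_minor_def
      proof (intro exI[of _ "B \<circ> ?g"] conjI)
      show "\<forall>v\<in>verts ?G. (B \<circ> ?g) v \<subseteq> verts H \<and> connected_graph (induce H ((B \<circ> ?g) v))
          \<and> radius_at_most (induce H ((B \<circ> ?g) v)) d"
        using B1 f by simp
      show "\<forall>u\<in>verts ?G. \<forall>v\<in>verts ?G. u \<noteq> v \<longrightarrow> (B \<circ> ?g) u \<inter> (B \<circ> ?g) v = {}"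
      proof (intro ballI impI)
        fix i j assume "i \<in> verts ?G" "j \<in> verts ?G" "i \<noteq> j"
        then obtain u v where "i = f u" "u \<in> V" "j = f v" "v \<in> V" "u \<noteq> v" by auto
        then show "(B \<circ> ?g) i \<inter> (B \<circ> ?g) j = {}" using B2 f by simp
      qed
      show "\<forall>u\<in>verts ?G. \<forall>v\<in>verts ?G. adj ?G u v \<longrightarrow>
          (\<exists>x\<in>(B \<circ> ?g) u. \<exists>y\<in>(B \<circ> ?g) v. adj H x y)"
        using B3 f adj VE by simp
    qed
    from a[OF H simple this] have "real (card ((`) f ` E)) \<le> a * real (card (f ` V))" by simp
    then show ?thesis
      unfolding card_image[OF injE] card_image[OF f] VE by simp
  qed
  then show ?thesis by blast
qed

end

theory Submission
  imports Defs
begin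

text \<open>For every \<open>k\<close>-valid edge \<open>e\<close> we grow a subtree \<open>K e\<close> of an induced tree containing \<open>e\<close>, one vertex
  \<open>y e\<close> at a time, so that each vertex always lies in boundedly many of the sets \<open>K e\<close>. Since \<open>G\<close> has an
  orientation of bounded indegree, the edges fall into boundedly many classes such that, within a
  class, the sets \<open>K e\<close> are disjoint and not joined by edges. Contracting the \<open>K e\<close> of one class into
  \<open>y e\<close> gives a shallow minor, hence a sparse graph, and colouring it splits the vertices \<open>y e\<close> into
  boundedly many groups in which distinct apexes do not interact. So the union of the trees
  \<open>K e \<union> {y e}\<close> over one class and one group is an induced forest whose components are the unions over a
  common apex. An apex shared by at least \<open>k\<close> edges of the class gives a component with at least \<open>k\<close>
  edges, which settles these edges; for the other edges \<open>K e \<union> {y e}\<close> still has bounded overlap, and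
  we continue with it. After \<open>k\<close> steps the trees have \<open>k\<close> edges themselves.\<close>

section \<open>Sparse set systems\<close>

text \<open>The bound is imposed on every vertex subset, so it survives the deletion of vertices.
  Members of \<open>E\<close> may be arbitrary sets; the degrees below count only the pairs among
  them.\<close>

definition sparse :: "nat \<Rightarrow> 'b set \<Rightarrow> 'b set set \<Rightarrow> bool" where
  "sparse c V E \<longleftrightarrow> (\<forall>S \<subseteq> V. finite {e \<in> E. e \<subseteq> S} \<and> card {e \<in> E. e \<subseteq> S} \<le> c * card S)"

lemma sparse_mono_set: "sparse c V E \<Longrightarrow> W \<subseteq> V \<Longrightarrow> sparse c W E"
  unfolding sparse_def by blast

lemma card_UN_le_mult:
  assumes "finite I" "\<And>i. i \<in> I \<Longrightarrow> card (A i) \<le> c"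
  shows "card (\<Union>i\<in>I. A i) \<le> c * card I"
proof -
  have "card (\<Union>i\<in>I. A i) \<le> (\<Sum>i\<in>I. card (A i))"
    by (rule card_UN_le[OF assms(1)])
  also have "\<dots> \<le> of_nat (card I) * c"
    by (rule sum_bounded_above) (rule assms(2))
  finally show ?thesis by (simp add: mult.commute)
qed

text \<open>Charging scheme: a member of \<open>E\<close> inside \<open>S\<close> either lies in
  \<open>A\<close>, of size at most \<open>a * card S\<close>, or is charged to some
  \<open>v\<close> in \<open>S\<close>, which receives at most \<open>c\<close> of them. Later
  \<open>A\<close> is the edge set of a shallow minor, or empty.\<close>

lemma sparseI:
  assumes V: "finite V"
    and *: "\<And>S. S \<subseteq> V \<Longrightarrow> \<exists>A Q. {e \<in> E. e \<subseteq> S} \<subseteq> A \<union> (\<Union>v\<in>S. Q v) \<and>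
      finite A \<and> card A \<le> a * card S \<and> (\<forall>v\<in>S. finite (Q v) \<and> card (Q v) \<le> c)"
  shows "sparse (a + c) V E"
  unfolding sparse_def
proof (intro allI impI)
  fix S assume S: "S \<subseteq> V"
  then have finS: "finite S" using V by (rule finite_subset)
  from *[OF S] obtain A Q where "{e \<in> E. e \<subseteq> S} \<subseteq> A \<union> (\<Union>v\<in>S. Q v) \<and>
      finite A \<and> card A \<le> a * card S \<and> (\<forall>v\<in>S. finite (Q v) \<and> card (Q v) \<le> c)" by (elim exE)
  then have AQ: "{e \<in> E. e \<subseteq> S} \<subseteq> A \<union> (\<Union>v\<in>S. Q v)" "finite A" "card A \<le> a * card S"
    and Q: "\<And>v. v \<in> S \<Longrightarrow> finite (Q v)" "\<And>v. v \<in> S \<Longrightarrow> card (Q v) \<le> c"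
    by simp_all
  have fin: "finite (A \<union> (\<Union>v\<in>S. Q v))" using AQ(2) finS Q(1) by simp
  have "card {e \<in> E. e \<subseteq> S} \<le> card A + card (\<Union>v\<in>S. Q v)"
    using card_mono[OF fin AQ(1)] card_Un_le le_trans by blast
  also have "\<dots> \<le> a * card S + c * card S"
    using AQ(3) card_UN_le_mult[OF finS Q(2)] by (rule add_mono)
  finally show "finite {e \<in> E. e \<subseteq> S} \<and> card {e \<in> E. e \<subseteq> S} \<le> (a + c) * card S"
    using finite_subset[OF AQ(1) fin] by (simp add: algebra_simps)
qed

text \<open>Average degree: if every vertex had more than \<open>2 * c\<close> neighbours, double
  counting the incidences with pairs would give
  \<open>(2 * c + 1) * card V \<le> 2 * (c * card V)\<close>.\<close>

lemma sparse_low_degree: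
  assumes V: "finite V" "V \<noteq> {}" and sp: "sparse c V E"
  shows "\<exists>v\<in>V. card {u \<in> V - {v}. {u, v} \<in> E} \<le> 2 * c"
proof (rule ccontr)
  assume neg: "\<not> ?thesis"
  define F where "F = {e \<in> E. e \<subseteq> V \<and> card e = 2}"
  have finE: "finite {e \<in> E. e \<subseteq> V}" and cardE: "card {e \<in> E. e \<subseteq> V} \<le> c * card V"
    using sp unfolding sparse_def by auto
  have F: "F \<subseteq> {e \<in> E. e \<subseteq> V}" by (auto simp: F_def)
  then have finF: "finite F" and cardF: "card F \<le> c * card V"
    using finE card_mono[OF finE F] cardE by (auto intro: finite_subset)
  have deg: "2 * c + 1 \<le> card {e \<in> F. v \<in> e}" if v: "v \<in> V" for v
  proof -
    have "2 * c + 1 \<le> card {u \<in> V - {v}. {u, v} \<in> E}"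
      using neg v by (auto simp: not_le)
    also have "\<dots> = card ((\<lambda>u. {u, v}) ` {u \<in> V - {v}. {u, v} \<in> E})"
      by (rule card_image[symmetric]) (auto simp: inj_on_def doubleton_eq_iff)
    also have "\<dots> \<le> card {e \<in> F. v \<in> e}"
    proof (rule card_mono)
      show "finite {e \<in> F. v \<in> e}" using finF by simp
    qed (use v in \<open>auto simp: F_def\<close>)
    finally show ?thesis .
  qed
  have "card V * (2 * c + 1) \<le> (\<Sum>v\<in>V. card {e \<in> F. v \<in> e})"
    using sum_bounded_below[of V "2 * c + 1" "\<lambda>v. card {e \<in> F. v \<in> e}"] deg by simp
  also have "\<dots> = (\<Sum>e\<in>F. card {v \<in> V. v \<in> e})"
    using sum.swap_restrict[OF V(1) finF, of "\<lambda>_ _. 1::nat" "\<lambda>v e. v \<in> e"] by simp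
  also have "\<dots> = (\<Sum>e\<in>F. 2)"
  proof (rule sum.cong[OF refl])
    fix e assume "e \<in> F"
    then have "{v \<in> V. v \<in> e} = e" "card e = 2" by (auto simp: F_def)
    then show "card {v \<in> V. v \<in> e} = 2" by simp
  qed
  also have "\<dots> \<le> 2 * (c * card V)" using cardF by simp
  finally have "card V \<le> 0" by (simp add: algebra_simps)
  then show False using V by simp
qed

text \<open>Greedy colouring: a vertex with at most \<open>2 * c\<close> neighbours is removed, the
  rest is coloured by induction, and one of the \<open>2 * c + 1\<close> colours remains free for
  it.\<close>

lemma sparse_coloring:
  assumes "finite V" "sparse c V E"
  shows "\<exists>f :: 'b \<Rightarrow> nat. (\<forall>v. f v \<le> 2 * c) \<and>
    (\<forall>u\<in>V. \<forall>v\<in>V. u \<noteq> v \<and> {u, v} \<in> E \<longrightarrow> f u \<noteq> f v)"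
  using assms
proof (induction V rule: finite_psubset_induct)
  case (psubset V)
  show ?case
  proof (cases "V = {}")
    case True
    then show ?thesis by (intro exI[of _ "\<lambda>_. 0"]) simp
  next
    case False
    then obtain v where v: "v \<in> V" and d: "card {u \<in> V - {v}. {u, v} \<in> E} \<le> 2 * c"
      using sparse_low_degree psubset.hyps psubset.prems by blast
    let ?N = "{u \<in> V - {v}. {u, v} \<in> E}"
    obtain f :: "'b \<Rightarrow> nat" where f: "\<forall>v. f v \<le> 2 * c"
      and proper: "\<forall>u\<in>V - {v}. \<forall>w\<in>V - {v}. u \<noteq> w \<and> {u, w} \<in> E \<longrightarrow> f u \<noteq> f w"
      using psubset.IH[of "V - {v}"] v sparse_mono_set[OF psubset.prems, of "V - {v}"] by blast
    have "card (f ` ?N) < card {..2 * c}"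
      using card_image_le[of ?N f] d psubset.hyps by simp
    moreover have "finite (f ` ?N)" using psubset.hyps by simp
    ultimately have "\<not> {..2 * c} \<subseteq> f ` ?N" using card_mono leD by blast
    then obtain i where i: "i \<le> 2 * c" "i \<notin> f ` ?N" by auto
    show ?thesis
    proof (intro exI[of _ "f(v := i)"] conjI ballI impI)
      show "\<forall>w. (f(v := i)) w \<le> 2 * c" using f i by simp
    next
      fix u w assume "u \<in> V" "w \<in> V" "u \<noteq> w \<and> {u, w} \<in> E"
      then show "(f(v := i)) u \<noteq> (f(v := i)) w"
        using proper i(2) by (auto simp: insert_commute)
    qed
  qed
qed

text \<open>The same elimination order orients the pairs: when \<open>v\<close> is removed,
  \<open>N v\<close> collects its at most \<open>2 * c\<close> remaining neighbours, so the endpoint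
  removed first lists the other one.\<close>

lemma sparse_orientation:
  assumes "finite V" "sparse c V E"
  shows "\<exists>N. (\<forall>v. finite (N v) \<and> card (N v) \<le> 2 * c) \<and>
    (\<forall>u\<in>V. \<forall>v\<in>V. u \<noteq> v \<and> {u, v} \<in> E \<longrightarrow> u \<in> N v \<or> v \<in> N u)"
  using assms
proof (induction V rule: finite_psubset_induct)
  case (psubset V)
  show ?case
  proof (cases "V = {}")
    case True
    then show ?thesis by (intro exI[of _ "\<lambda>_. {}"]) simp
  next
    case False
    then obtain v where v: "v \<in> V" and d: "card {u \<in> V - {v}. {u, v} \<in> E} \<le> 2 * c"
      using sparse_low_degree psubset.hyps psubset.prems by blast
    obtain N where N: "\<forall>v. finite (N v) \<and> card (N v) \<le> 2 * c"
      and ori: "\<forall>u\<in>V - {v}. \<forall>w\<in>V - {v}. u \<noteq> w \<and> {u, w} \<in> E \<longrightarrow> u \<in> N w \<or> w \<in> N u"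
      using psubset.IH[of "V - {v}"] v sparse_mono_set[OF psubset.prems, of "V - {v}"] by blast
    show ?thesis
    proof (intro exI[of _ "N(v := {u \<in> V - {v}. {u, v} \<in> E})"] conjI ballI impI)
      show "\<forall>w. finite ((N(v := {u \<in> V - {v}. {u, v} \<in> E})) w) \<and>
          card ((N(v := {u \<in> V - {v}. {u, v} \<in> E})) w) \<le> 2 * c"
        using N d psubset.hyps by simp
    next
      fix u w assume "u \<in> V" "w \<in> V" "u \<noteq> w \<and> {u, w} \<in> E"
      then show "u \<in> (N(v := {u \<in> V - {v}. {u, v} \<in> E})) w \<or>
          w \<in> (N(v := {u \<in> V - {v}. {u, v} \<in> E})) u"
        using ori by (auto simp: insert_commute)
    qed
  qed
qed

section \<open>Induced subgraphs\<close>

lemma adj_commute: "adj G u v \<longleftrightarrow> adj G v u"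
  by (simp add: adj_def insert_commute)

lemma adj_simple:
  assumes "simple_graph G" "adj G u v"
  shows "u \<in> verts G" "v \<in> verts G" "u \<noteq> v"
proof -
  obtain x y where "x \<in> verts G" "y \<in> verts G" "x \<noteq> y" "{u, v} = {x, y}"
    using assms unfolding simple_graph_def adj_def by meson
  then show "u \<in> verts G" "v \<in> verts G" "u \<noteq> v" by (auto simp: doubleton_eq_iff)
qed

lemma verts_induce [simp]: "verts (induce G X) = X"
  and edges_induce [simp]: "edges (induce G X) = {e \<in> edges G. e \<subseteq> X}"
  and adj_induce [simp]: "adj (induce G X) u v \<longleftrightarrow> u \<in> X \<and> v \<in> X \<and> adj G u v"
  by (auto simp: induce_def adj_def)

lemma induce_induce: "Y \<subseteq> X \<Longrightarrow> induce (induce G X) Y = induce G Y"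
  by (auto simp: induce_def)

section \<open>Walks and connectedness in induced subgraphs\<close>

lemma walk_imp_rtranclp:
  assumes "walk (induce G X) u p v"
  shows "(adj (induce G X))\<^sup>*\<^sup>* u v"
  using assms
proof (induction p arbitrary: u)
  case Nil
  then show ?case by (simp add: walk_def)
next
  case (Cons a p)
  show ?case
  proof (cases p)
    case Nil
    then show ?thesis using Cons.prems by (auto simp: walk_def)
  next
    case (Cons b q)
    then have "adj (induce G X) u b" "walk (induce G X) b p v"
      using Cons.prems by (auto simp: walk_def simp del: adj_induce)
    then show ?thesis using Cons.IH by (meson converse_rtranclp_into_rtranclp)
  qed
qed

text \<open>When a vertex to be prepended already lies on the walk, the walk is cut down to the
  suffix starting there. Distinctness serves to build cycles and to bound the length of walks in
  small sets.\<close>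

lemma rtranclp_imp_distinct_walk:
  assumes "(adj (induce G X))\<^sup>*\<^sup>* u v" "v \<in> X"
  shows "\<exists>p. walk (induce G X) u p v \<and> distinct p"
  using assms(1)
proof (induction rule: converse_rtranclp_induct)
  case base
  then show ?case using assms(2) by (intro exI[of _ "[v]"]) (simp add: walk_def)
next
  case (step u w)
  then obtain p where p: "walk (induce G X) w p v" "distinct p" by blast
  show ?case
  proof (cases "u \<in> set p")
    case True
    then obtain xs ys where xy: "p = xs @ u # ys" by (meson split_list)
    have "walk (induce G X) u (u # ys) v"
      using p(1) unfolding xy walk_def by (auto simp: successively_append_iff simp del: adj_induce)
    then show ?thesis using p(2) xy by auto
  next
    case False
    have "walk (induce G X) u (u # p) v"
      using p(1) step.hyps(1) unfolding walk_def
      by (cases p) (auto simp del: adj_induce, auto)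
    then show ?thesis using p(2) False by (meson distinct.simps(2))
  qed
qed

text \<open>Closures replace walks for the sake of their induction and monotonicity rules. The
  premise \<open>v \<in> X\<close> provides the trivial walk in the case
  \<open>u = v\<close>.\<close>

lemma reachable_induce_iff:
  "v \<in> X \<Longrightarrow> reachable (induce G X) u v \<longleftrightarrow> (adj (induce G X))\<^sup>*\<^sup>* u v"
  unfolding reachable_def using walk_imp_rtranclp rtranclp_imp_distinct_walk by metis

lemma connected_induce_iff:
  "connected_graph (induce G X) \<longleftrightarrow>
    X \<noteq> {} \<and> (\<forall>u\<in>X. \<forall>v\<in>X. (adj (induce G X))\<^sup>*\<^sup>* u v)"
  by (auto simp: connected_graph_def reachable_induce_iff simp del: adj_induce)

lemma rtranclp_induce_mono:
  assumes "(adj (induce G X))\<^sup>*\<^sup>* u v" "X \<subseteq> Y"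
  shows "(adj (induce G Y))\<^sup>*\<^sup>* u v"
  using assms(1) by (rule rtranclp_mono[THEN predicate2D, rotated]) (use assms(2) in auto)

lemma rtranclp_induce_commute:
  assumes "(adj (induce G X))\<^sup>*\<^sup>* u v"
  shows "(adj (induce G X))\<^sup>*\<^sup>* v u"
proof -
  have "symp (adj (induce G X))" by (auto simp: symp_def adj_commute)
  then show ?thesis using assms by (meson symp_rtranclp sympD)
qed

lemma connected_induceI:
  assumes "c \<in> X" "\<And>x. x \<in> X \<Longrightarrow> (adj (induce G X))\<^sup>*\<^sup>* c x"
  shows "connected_graph (induce G X)"
  unfolding connected_induce_iff
proof (intro conjI ballI)
  show "X \<noteq> {}" using assms(1) by blast
  fix u v assume "u \<in> X" "v \<in> X"
  then show "(adj (induce G X))\<^sup>*\<^sup>* u v"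
    using assms(2) by (meson rtranclp_induce_commute rtranclp_trans)
qed

lemma connected_induce_singleton: "connected_graph (induce G {v})"
  by (rule connected_induceI[of v]) auto

lemma connected_induce_Union:
  assumes "\<And>i. i \<in> I \<Longrightarrow> connected_graph (induce G (A i))" "\<And>i. i \<in> I \<Longrightarrow> c \<in> A i" "I \<noteq> {}"
  shows "connected_graph (induce G (\<Union>i\<in>I. A i))"
proof (rule connected_induceI)
  show "c \<in> (\<Union>i\<in>I. A i)" using assms(2,3) by blast
next
  fix x assume "x \<in> (\<Union>i\<in>I. A i)"
  then obtain i where i: "i \<in> I" "x \<in> A i" by blast
  then have "(adj (induce G (A i)))\<^sup>*\<^sup>* c x"
    using assms(1,2) unfolding connected_induce_iff by blast
  then show "(adj (induce G (\<Union>i\<in>I. A i)))\<^sup>*\<^sup>* c x"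
    by (rule rtranclp_induce_mono) (use i in blast)
qed

lemma connected_induce_insert:
  assumes "connected_graph (induce G K)" "x \<in> K" "adj G x y"
  shows "connected_graph (induce G (insert y K))"
proof -
  have "connected_graph (induce G {x, y})"
    by (rule connected_induceI[of x]) (use assms(3) in auto)
  \<comment> \<open>The union of two sets is indexed by \<open>bool\<close> to fit the general
    lemma; the common point is \<open>x\<close>.\<close>
  then have "connected_graph (induce G (\<Union>i\<in>UNIV. if i then K else {x, y}))"
    using assms(1,2) by (intro connected_induce_Union[where c = x]) auto
  moreover have "(\<Union>i\<in>UNIV. if i then K else {x, y}) = insert y K"
    using assms(2) by (auto simp: UNIV_bool)
  ultimately show ?thesis by simp
qed

text \<open>Otherwise \<open>K\<close> would be closed under adjacency inside \<open>T\<close>, and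
  no walk could leave it.\<close>

lemma connected_crossing_edge:
  assumes "connected_graph (induce G T)" "K \<subset> T" "K \<noteq> {}"
  shows "\<exists>x\<in>K. \<exists>y\<in>T - K. adj G x y"
proof (rule ccontr)
  assume neg: "\<not> ?thesis"
  obtain u v where uv: "u \<in> K" "v \<in> T - K" using assms(2,3) by blast
  then have "(adj (induce G T))\<^sup>*\<^sup>* u v"
    using assms(1,2) unfolding connected_induce_iff by blast
  then have "v \<in> K"
    by (induction rule: rtranclp_induct) (use uv(1) neg in auto)
  then show False using uv(2) by blast
qed

section \<open>Cycles and acyclic induced subgraphs\<close>

lemma cycle_induce_cong:
  assumes "cycle (induce G X) p" "set p \<subseteq> Y"
  shows "cycle (induce G Y) p"
proof -
  have p: "p \<noteq> []" using assms(1) by (auto simp: cycle_def)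
  have "successively (adj (induce G Y)) p"
    using assms by (auto simp: cycle_def walk_def intro: successively_mono)
  then show ?thesis
    using assms p by (auto simp: cycle_def walk_def subset_iff)
qed

lemma acyclic_induce_subset:
  assumes "acyclic_graph (induce G X)" "Y \<subseteq> X"
  shows "acyclic_graph (induce G Y)"
  unfolding acyclic_graph_def
proof
  assume "\<exists>p. cycle (induce G Y) p"
  then obtain p where p: "cycle (induce G Y) p" by blast
  then have "set p \<subseteq> X" using assms(2) by (auto simp: cycle_def walk_def)
  then show False using cycle_induce_cong[OF p] assms(1) by (auto simp: acyclic_graph_def)
qed

text \<open>A cycle has three distinct vertices. This serves the start of the growth, where the tree
  is a single edge.\<close>

lemma acyclic_induce_small:
  assumes "finite X" "card X \<le> 2"
  shows "acyclic_graph (induce G X)"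
  unfolding acyclic_graph_def
proof
  assume "\<exists>p. cycle (induce G X) p"
  then obtain p where "3 \<le> length p" "distinct p" "set p \<subseteq> X"
    by (auto simp: cycle_def walk_def)
  then show False
    using card_mono[OF assms(1), of "set p"] assms(2) by (simp add: distinct_card)
qed

lemma cycle_rotate:
  assumes "cycle G (xs @ y # ys)"
  shows "cycle G (y # ys @ xs)"
proof (cases xs)
  case Nil
  then show ?thesis using assms by simp
next
  case (Cons a as)
  then show ?thesis
    using assms by (auto simp: cycle_def walk_def successively_append_iff successively_Cons
        split: if_splits)
qed

text \<open>A second neighbour would close a cycle through a path inside \<open>K\<close>.\<close>

lemma acyclic_unique_neighbour:
  assumes acy: "acyclic_graph (induce G T)" and K: "connected_graph (induce G K)" "K \<subseteq> T"
    and y: "y \<in> T - K" and x: "x \<in> K" "adj G x y" and x': "x' \<in> K" "adj G x' y"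
  shows "x = x'"
proof (rule ccontr)
  assume "x \<noteq> x'"
  have "(adj (induce G K))\<^sup>*\<^sup>* x x'" using K(1) x(1) x'(1) unfolding connected_induce_iff by blast
  then obtain p where p: "walk (induce G K) x p x'" "distinct p"
    using rtranclp_imp_distinct_walk x'(1) by metis
  have "length p \<noteq> 0" "length p \<noteq> 1"
    using p(1) \<open>x \<noteq> x'\<close> by (auto simp: walk_def length_Suc_conv)
  \<comment> \<open>Two vertices on \<open>p\<close> suffice for \<open>y # p\<close> to reach the
    minimal cycle length 3.\<close>
  then have len: "2 \<le> length p" by linarith
  have pK: "set p \<subseteq> K" "p \<noteq> []" "hd p = x" "last p = x'" using p(1) by (auto simp: walk_def)
  have "successively (adj (induce G T)) p"
    using p(1) K(2) by (auto simp: walk_def intro: successively_mono)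
  moreover have "adj (induce G T) y x" "adj (induce G T) x' y"
    using x x' y K(2) by (auto simp: adj_commute)
  ultimately have "cycle (induce G T) (y # p)"
    using p(2) pK len y K(2)
    by (auto simp: cycle_def walk_def successively_Cons simp del: adj_induce)
  then show False using acy by (auto simp: acyclic_graph_def)
qed

text \<open>The only new edge is \<open>{x, y}\<close>. Vertices and edges thus grow in step, which
  preserves the equation between their numbers while trees grow.\<close>

lemma card_edges_insert:
  assumes G: "simple_graph G" and y: "y \<notin> K" and x: "x \<in> K" "adj G x y"
    and uniq: "\<And>x'. x' \<in> K \<Longrightarrow> adj G x' y \<Longrightarrow> x' = x"
  shows "card (edges (induce G (insert y K))) = Suc (card (edges (induce G K)))"
proof -
  have "edges (induce G (insert y K)) = insert {x, y} (edges (induce G K))"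
  proof
    show "edges (induce G (insert y K)) \<subseteq> insert {x, y} (edges (induce G K))"
    proof
      fix e assume e: "e \<in> edges (induce G (insert y K))"
      show "e \<in> insert {x, y} (edges (induce G K))"
      proof (cases "y \<in> e")
        case True
        obtain u v where "u \<noteq> v" "e = {u, v}"
          using e G by (auto simp: simple_graph_def)
        with True obtain z where z: "e = {z, y}" "z \<noteq> y" by (auto simp: insert_commute)
        then have "z = x" using e uniq[of z] by (auto simp: adj_def)
        then show ?thesis using z by simp
      next
        case False
        then show ?thesis using e by auto
      qed
    qed
  qed (use x in \<open>auto simp: adj_def\<close>)
  moreover have "finite (edges (induce G K))" "{x, y} \<notin> edges (induce G K)"
    using simple_graph_finite_edges[OF G] y by auto
  ultimately show ?thesis by simp
qed

text \<open>Rotated so that it starts in an apex if it meets one, a cycle never leaves the first block that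
  it enters. The sets \<open>Y i\<close> may be empty, which covers unions of separated trees.\<close>

lemma acyclic_glue:
  assumes G: "simple_graph G"
    and acy: "\<And>i. i \<in> I \<Longrightarrow> acyclic_graph (induce G (K i \<union> Y i))"
    and Y1: "\<And>i. i \<in> I \<Longrightarrow> Y i \<subseteq> {y i}"
    and KK: "\<And>i j u v. i \<in> I \<Longrightarrow> j \<in> I \<Longrightarrow> u \<in> K i \<Longrightarrow> v \<in> K j \<Longrightarrow> adj G u v \<Longrightarrow> i = j"
    and YK: "\<And>i j u v. i \<in> I \<Longrightarrow> j \<in> I \<Longrightarrow> u \<in> Y i \<Longrightarrow> v \<in> K j \<Longrightarrow> adj G u v \<Longrightarrow> u \<in> Y j"
    and YY: "\<And>i j u v. i \<in> I \<Longrightarrow> j \<in> I \<Longrightarrow> u \<in> Y i \<Longrightarrow> v \<in> Y j \<Longrightarrow> \<not> adj G u v"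
  shows "acyclic_graph (induce G (\<Union>i\<in>I. K i \<union> Y i))"
proof -
  let ?U = "\<Union>i\<in>I. K i \<union> Y i"
  \<comment> \<open>The next vertex \<open>b\<close> lies in some \<open>K j\<close> or
    \<open>Y j\<close>. In the first case \<open>KK\<close> forces \<open>j = i\<close>; in the
    second \<open>YK\<close> puts \<open>b\<close> into \<open>Y i\<close>, which the path
    avoids.\<close>
  have stay: "set q \<subseteq> K i"
    if "successively (adj (induce G ?U)) q" "q \<noteq> []" "hd q \<in> K i" "set q \<inter> Y i = {}" "i \<in> I" for q i
    using that
  proof (induction q)
    case (Cons a q)
    show ?case
    proof (cases q)
      case Nil
      then show ?thesis using Cons.prems by simp
    next
      case (Cons b r)
      have ab: "a \<in> K i" "adj G a b" "b \<in> ?U" "b \<notin> Y i"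
        using Cons.prems Cons by auto
      then obtain j where j: "j \<in> I" "b \<in> K j \<or> b \<in> Y j" by blast
      have "b \<in> K i"
        using j KK[OF Cons.prems(5) j(1) ab(1) _ ab(2)] YK[OF j(1) Cons.prems(5) _ ab(1)] ab
        by (auto simp: adj_commute)
      then have "set q \<subseteq> K i" using Cons.IH Cons.prems Cons by auto
      then show ?thesis using ab by simp
    qed
  qed simp
  have False if p: "cycle (induce G ?U) p" for p
  proof -
    have "\<exists>i\<in>I. \<exists>q. cycle (induce G ?U) q \<and> set q \<subseteq> K i \<union> Y i"
    proof (cases "\<exists>i\<in>I. set p \<inter> Y i \<noteq> {}")
      case True
      then obtain i z where i: "i \<in> I" "z \<in> Y i" "z \<in> set p" by blast
      then obtain xs ys where "p = xs @ z # ys" by (meson split_list)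
      then have c: "cycle (induce G ?U) (z # ys @ xs)" using p cycle_rotate by metis
      define q where "q = ys @ xs"
      have q: "cycle (induce G ?U) (z # q)" using c by (simp add: q_def)
      then have q': "q \<noteq> []" "z \<notin> set q" "adj (induce G ?U) z (hd q)" "successively (adj (induce G ?U)) q"
        by (auto simp: cycle_def walk_def successively_Cons simp del: adj_induce)
      then obtain j where j: "j \<in> I" "hd q \<in> K j \<or> hd q \<in> Y j" by auto
      have zh: "adj G z (hd q)" using q'(3) by simp
      \<comment> \<open>Apexes are never adjacent, so the vertex after \<open>z\<close> lies in a
        block \<open>K j\<close>. By \<open>YK\<close> the apex of that block is \<open>z\<close>
        itself, which the rest of the cycle does not meet again.\<close>
      have "hd q \<in> K j" using j zh YY[OF i(1) j(1) i(2)] by blast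
      then have zj: "z \<in> Y j" using YK[OF i(1) j(1) i(2) _ zh] by blast
      then have "Y j = {z}" using Y1[OF j(1)] by blast
      then have "set q \<subseteq> K j" using stay[OF q'(4,1) \<open>hd q \<in> K j\<close> _ j(1)] q'(2) by auto
      then show ?thesis using q zj j(1) by (intro bexI[of _ j] exI[of _ "z # q"]) auto
    next
      case False
      have p': "p \<noteq> []" "set p \<subseteq> ?U" "successively (adj (induce G ?U)) p"
        using p by (auto simp: cycle_def walk_def simp del: adj_induce)
      then have "hd p \<in> ?U" by (meson hd_in_set subsetD)
      then obtain j where j: "j \<in> I" "hd p \<in> K j"
        using False p'(1) hd_in_set by blast
      then have "set p \<subseteq> K j" using stay[OF p'(3,1) j(2) _ j(1)] False by blast
      then show ?thesis using p j(1) by blast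
    qed
    then show False using acy cycle_induce_cong unfolding acyclic_graph_def by metis
  qed
  then show ?thesis by (auto simp: acyclic_graph_def)
qed

section \<open>Strong forests and their components\<close>

lemma strong_forestI:
  assumes G: "simple_graph G" and U: "U \<subseteq> verts G" "acyclic_graph (induce G U)"
    and large: "\<And>x. x \<in> U \<Longrightarrow> \<exists>Z\<subseteq>U. x \<in> Z \<and> connected_graph (induce G Z) \<and> k \<le> card (edges (induce G Z))"
  shows "strong_forest k G (induce G U)"
  unfolding strong_forest_def
proof (intro conjI ballI)
  show "induced_forest G (induce G U)"
    using U by (auto simp: induced_forest_def induced_subgraph_def)
next
  fix C assume "C \<in> components (induce G U)"
  then obtain x where x: "x \<in> U" and C: "C = induce (induce G U) {v \<in> U. reachable (induce G U) x v}"
    by (auto simp: components_def)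
  obtain Z where Z: "Z \<subseteq> U" "x \<in> Z" "connected_graph (induce G Z)" "k \<le> card (edges (induce G Z))"
    using large[OF x] by blast
  \<comment> \<open>A connected set around \<open>x\<close> lies within the component of
    \<open>x\<close>, so its edges count for that component.\<close>
  have "Z \<subseteq> {v \<in> U. reachable (induce G U) x v}"
    using Z(1-3) unfolding connected_induce_iff
    by (auto simp: reachable_induce_iff subset_iff simp del: adj_induce
        intro: rtranclp_induce_mono[OF _ Z(1)])
  then have "edges (induce G Z) \<subseteq> edges C" using Z(1) by (auto simp: C)
  moreover have "finite (edges C)" using simple_graph_finite_edges[OF G] by (auto simp: C)
  ultimately show "k \<le> card (edges C)" using Z(4) card_mono by (meson le_trans)
qed

text \<open>\<open>T\<close> is the component of an endpoint of \<open>e\<close> in a strong forest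
  containing \<open>e\<close>. This tree then serves as the room in which smaller subtrees
  grow.\<close>

lemma valid_edge_tree:
  assumes G: "simple_graph G" and e: "valid_edge k G e"
  shows "\<exists>T \<subseteq> verts G. e \<subseteq> T \<and> connected_graph (induce G T) \<and> acyclic_graph (induce G T) \<and>
    k \<le> card (edges (induce G T))"
proof -
  obtain F where F: "strong_forest k G F" "e \<in> edges F" using e by (auto simp: valid_edge_def)
  then obtain S where S: "S \<subseteq> verts G" "F = induce G S"
    unfolding strong_forest_def induced_forest_def induced_subgraph_def by blast
  note S = S(1) F(1)[unfolded S(2)] F(2)[unfolded S(2)]
  then have eS: "e \<in> edges G" "e \<subseteq> S" by auto
  obtain u v where uv: "u \<noteq> v" "e = {u, v}"
    using eS(1) G by (auto simp: simple_graph_def)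
  define T where "T = {w \<in> S. reachable (induce G S) u w}"
  have T: "T \<subseteq> S" by (auto simp: T_def)
  have T_iff: "w \<in> T \<longleftrightarrow> w \<in> S \<and> (adj (induce G S))\<^sup>*\<^sup>* u w" for w
    by (auto simp: T_def reachable_induce_iff simp del: adj_induce)
  have uS: "u \<in> S" "v \<in> S" "adj (induce G S) u v" using eS uv by (auto simp: adj_def)
  then have uT: "u \<in> T" "v \<in> T" by (auto simp: T_iff simp del: adj_induce)
  \<comment> \<open>Reachability is known inside \<open>S\<close>; every vertex on the way is itself
    reachable from \<open>u\<close>, hence in \<open>T\<close>.\<close>
  have "(adj (induce G T))\<^sup>*\<^sup>* u w" if "(adj (induce G S))\<^sup>*\<^sup>* u w" for w
    using that
  proof (induction rule: rtranclp_induct)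
    case (step y z)
    have "y \<in> T" using step.hyps by (auto simp: T_iff simp del: adj_induce) (simp_all)
    moreover have "z \<in> T" using step.hyps(1,2)
      by (metis T_iff adj_induce rtranclp.rtrancl_into_rtrancl)
    ultimately have "adj (induce G T) y z" using step.hyps(2) by simp
    then show ?case using step.IH by (rule rtranclp.rtrancl_into_rtrancl[rotated])
  qed simp
  then have "connected_graph (induce G T)"
    using uT by (intro connected_induceI[of u]) (auto simp: T_iff simp del: adj_induce)
  moreover have "acyclic_graph (induce G T)"
    using S(2) T by (auto simp: strong_forest_def induced_forest_def intro: acyclic_induce_subset)
  moreover have "induce G T \<in> components (induce G S)"
    unfolding components_def verts_induce
    using uS(1) induce_induce[OF T, of G, symmetric] by (intro image_eqI[of _ _ u]) (simp_all add: T_def)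
  then have "k \<le> card (edges (induce G T))"
    using S(2) unfolding strong_forest_def by blast
  ultimately show ?thesis using uT uv T S(1) by (intro exI[of _ T]) auto
qed

section \<open>Covers by strong forests\<close>

definition separated :: "'a ugraph \<Rightarrow> 'a set \<Rightarrow> 'a set \<Rightarrow> bool" where
  "separated G A B \<longleftrightarrow> A \<inter> B = {} \<and> (\<forall>u\<in>A. \<forall>v\<in>B. \<not> adj G u v)"

text \<open>The number \<open>c\<close> is only an upper bound and \<open>X\<close> is any set to be
  covered, so that covers of pieces combine by adding their bounds.\<close>

definition forest_cover :: "'a ugraph \<Rightarrow> nat \<Rightarrow> nat \<Rightarrow> 'a set set \<Rightarrow> bool" where
  "forest_cover G k c X \<longleftrightarrow> (\<exists>\<F>. finite \<F> \<and> card \<F> \<le> c \<and> (\<forall>F\<in>\<F>. strong_forest k G F) \<and>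
    X \<subseteq> \<Union> (edges ` \<F>))"

lemma forest_cover_single: "strong_forest k G F \<Longrightarrow> X \<subseteq> edges F \<Longrightarrow> forest_cover G k 1 X"
  unfolding forest_cover_def by (intro exI[of _ "{F}"]) auto

lemma forest_cover_Un:
  assumes "forest_cover G k c X" "forest_cover G k d Y"
  shows "forest_cover G k (c + d) (X \<union> Y)"
proof -
  obtain A B where A: "finite A" "card A \<le> c" "\<forall>F\<in>A. strong_forest k G F" "X \<subseteq> \<Union> (edges ` A)"
    and B: "finite B" "card B \<le> d" "\<forall>F\<in>B. strong_forest k G F" "Y \<subseteq> \<Union> (edges ` B)"
    using assms unfolding forest_cover_def by metis
  have "card (A \<union> B) \<le> c + d" using card_Un_le[of A B] A(2) B(2) by linarith
  then show ?thesis
    unfolding forest_cover_def using A B by (intro exI[of _ "A \<union> B"]) (auto 0 3)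
qed

lemma forest_cover_UN:
  assumes "\<And>i. i < n \<Longrightarrow> forest_cover G k c (X i)" "Y \<subseteq> (\<Union>i<n. X i)"
  shows "forest_cover G k (n * c) Y"
proof -
  have "\<forall>i\<in>{..<n}. \<exists>\<F>. finite \<F> \<and> card \<F> \<le> c \<and> (\<forall>F\<in>\<F>. strong_forest k G F) \<and>
      X i \<subseteq> \<Union> (edges ` \<F>)"
    using assms(1) unfolding forest_cover_def by simp
  from bchoice[OF this] obtain A where *: "\<forall>i\<in>{..<n}. finite (A i) \<and> card (A i) \<le> c \<and>
      (\<forall>F\<in>A i. strong_forest k G F) \<and> X i \<subseteq> \<Union> (edges ` A i)" ..
  have A: "\<And>i. i < n \<Longrightarrow> finite (A i)" "\<And>i. i < n \<Longrightarrow> card (A i) \<le> c"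
    "\<And>i F. i < n \<Longrightarrow> F \<in> A i \<Longrightarrow> strong_forest k G F" "\<And>i. i < n \<Longrightarrow> X i \<subseteq> \<Union> (edges ` A i)"
    using * by simp_all
  have "card (\<Union>i<n. A i) \<le> c * card {..<n}" by (rule card_UN_le_mult) (use A in auto)
  moreover have "Y \<subseteq> \<Union> (edges ` (\<Union>i<n. A i))" using assms(2) A(4) by fastforce
  ultimately show ?thesis
    unfolding forest_cover_def using A(1,3)
    by (intro exI[of _ "\<Union>i<n. A i"]) (auto simp: mult.commute)
qed

text \<open>This is \<open>2 * s + 1\<close> for the sparseness constant \<open>s\<close> of the
  conflicts: a set of at most \<open>k + 1\<close> vertices has at most
  \<open>(1 + b) * Suc k\<close> vertices in its closed in-neighbourhood, each lying in at most
  \<open>m\<close> sets.\<close>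

definition conflict_colors :: "nat \<Rightarrow> nat \<Rightarrow> nat \<Rightarrow> nat" where
  "conflict_colors b k m = Suc (2 * (m * ((1 + b) * Suc k)))"

text \<open>Again \<open>2 * s + 1\<close>, where \<open>s\<close> adds the density \<open>a\<close>
  of a contracted minor to the at most \<open>1 + b * k + b\<close> pairs charged to a
  vertex.\<close>

definition apex_colors :: "nat \<Rightarrow> nat \<Rightarrow> nat \<Rightarrow> nat" where
  "apex_colors a b k = Suc (2 * (a + (1 + b * k + b)))"

text \<open>Here \<open>j\<close> is the number of vertices that the trees still lack and \<open>m\<close> bounds the number of trees
  through a vertex.\<close>

fun cover_bound :: "nat \<Rightarrow> nat \<Rightarrow> nat \<Rightarrow> nat \<Rightarrow> nat \<Rightarrow> nat" where
  "cover_bound a b k 0 m = conflict_colors b k m"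
| "cover_bound a b k (Suc j) m = conflict_colors b k m * apex_colors a b k +
    cover_bound a b k j (conflict_colors b k m * k + m)"

text \<open>What the argument takes from bounded expansion: \<open>N v\<close> holds the
  in-neighbours of \<open>v\<close> in a fixed orientation, and depth \<open>k\<close> fits the
  contraction of connected sets with at most \<open>k\<close> vertices into an adjacent
  apex.\<close>

locale sparse_graph =
  fixes G :: "'a ugraph" and N :: "'a \<Rightarrow> 'a set" and a b k :: nat
  assumes simple: "simple_graph G"
    and finite_N: "\<And>v. finite (N v)" and card_N: "\<And>v. card (N v) \<le> b"
    and orientation: "\<And>u v. adj G u v \<Longrightarrow> u \<in> N v \<or> v \<in> N u"
    and density: "\<And>H :: 'a ugraph. simple_graph H \<Longrightarrow> shallow_minor k H G \<Longrightarrow>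
      card (edges H) \<le> a * card (verts H)"
begin

lemma finite_vertex_subset: "X \<subseteq> verts G \<Longrightarrow> finite X"
  using simple finite_subset unfolding simple_graph_def by blast

text \<open>If two sets meet or are joined by an edge, the orientation shows it from one side: the
  closed in-neighbourhood \<open>M i\<close> meets \<open>K j\<close>, or \<open>M j\<close> meets
  \<open>K i\<close>. Charging each conflict to that side makes the conflict pairs sparse, and a
  proper colouring avoids them.\<close>

lemma conflict_coloring:
  assumes fin: "finite I" and K: "\<And>i. i \<in> I \<Longrightarrow> K i \<subseteq> verts G" "\<And>i. i \<in> I \<Longrightarrow> card (K i) \<le> Suc k"
    and m: "\<And>x. card {i \<in> I. x \<in> K i} \<le> m"
  shows "\<exists>f :: 'i \<Rightarrow> nat. (\<forall>i. f i < conflict_colors b k m) \<and>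
    (\<forall>i\<in>I. \<forall>j\<in>I. i \<noteq> j \<and> f i = f j \<longrightarrow> separated G (K i) (K j))"
proof -
  define M where "M i = (\<Union>x\<in>K i. insert x (N x))" for i
  define Q where "Q i = (\<Union>z\<in>M i. (\<lambda>j. {i, j}) ` {j \<in> I. z \<in> K j})" for i
  define E where "E = (\<Union>i\<in>I. Q i)"
  have finK: "finite (K i)" if "i \<in> I" for i using finite_vertex_subset[OF K(1)[OF that]] .
  have finM: "finite (M i)" if "i \<in> I" for i
    using finK[OF that] finite_N by (auto simp: M_def)
  have finQ: "finite (Q i)" if "i \<in> I" for i
    using finM[OF that] fin by (auto simp: Q_def)
  have "card (M i) \<le> (1 + b) * card (K i)" if "i \<in> I" for i
    unfolding M_def
  proof (rule card_UN_le_mult[OF finK[OF that]])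
    show "card (insert x (N x)) \<le> 1 + b" for x
      using card_insert_le_m1[of "1 + b" "N x" x] card_N[of x] by simp
  qed
  then have cardM: "card (M i) \<le> (1 + b) * Suc k" if "i \<in> I" for i
    using that mult_le_mono2[OF K(2)[OF that], of "1 + b"] le_trans by blast
  have "card (Q i) \<le> m * card (M i)" if "i \<in> I" for i
    unfolding Q_def
    by (rule card_UN_le_mult[OF finM[OF that]]) (use fin m in \<open>auto intro: card_image_le[THEN le_trans]\<close>)
  then have cardQ: "card (Q i) \<le> m * ((1 + b) * Suc k)" if "i \<in> I" for i
    using that mult_le_mono2[OF cardM[OF that], of m] le_trans by blast
  have "sparse (0 + m * ((1 + b) * Suc k)) I E"
  proof (rule sparseI[OF fin])
    fix S assume S: "S \<subseteq> I"
    have "{e \<in> E. e \<subseteq> S} \<subseteq> (\<Union>i\<in>S. Q i)" by (auto simp: E_def Q_def)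
    then show "\<exists>A Q. {e \<in> E. e \<subseteq> S} \<subseteq> A \<union> (\<Union>v\<in>S. Q v) \<and> finite A \<and> card A \<le> 0 * card S \<and>
        (\<forall>v\<in>S. finite (Q v) \<and> card (Q v) \<le> m * ((1 + b) * Suc k))"
      using finQ cardQ S by (intro exI[of _ "{}"] exI[of _ Q]) auto
  qed
  then obtain f :: "'i \<Rightarrow> nat" where f: "\<And>i. f i \<le> 2 * (0 + m * ((1 + b) * Suc k))"
    and proper: "\<And>i j. i \<in> I \<Longrightarrow> j \<in> I \<Longrightarrow> i \<noteq> j \<Longrightarrow> {i, j} \<in> E \<Longrightarrow> f i \<noteq> f j"
    using sparse_coloring[OF fin] by metis
  have "separated G (K i) (K j)" if ij: "i \<in> I" "j \<in> I" "i \<noteq> j" "f i = f j" for i j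
  proof -
    have E: "{i, j} \<in> E" if "z \<in> M i" "z \<in> K j" "i \<in> I" "j \<in> I" for i j z
      using that by (auto simp: E_def Q_def)
    have "{i, j} \<notin> E" using proper ij by blast
    then have "z \<notin> M i \<or> z \<notin> K j" "z \<notin> M j \<or> z \<notin> K i" for z
      using E[of z i j] E[of z j i] ij by (auto simp: insert_commute)
    then show ?thesis using orientation unfolding separated_def M_def by blast
  qed
  then show ?thesis using f by (intro exI[of _ f]) (auto simp: conflict_colors_def less_Suc_eq_le)
qed

end

section \<open>Contraction of one separated colour class into its apexes\<close>

locale separated_family = sparse_graph G N a b k
  for G :: "'a ugraph" and N a b k +
  fixes I :: "'i set" and K :: "'i \<Rightarrow> 'a set" and y :: "'i \<Rightarrow> 'a"
  assumes finite_I: "finite I"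
    and K_verts: "\<And>i. i \<in> I \<Longrightarrow> K i \<subseteq> verts G"
    and K_connected: "\<And>i. i \<in> I \<Longrightarrow> connected_graph (induce G (K i))"
    and K_card: "\<And>i. i \<in> I \<Longrightarrow> card (K i) \<le> k"
    and y_verts: "\<And>i. i \<in> I \<Longrightarrow> y i \<in> verts G - K i"
    and y_adj: "\<And>i. i \<in> I \<Longrightarrow> \<exists>x\<in>K i. adj G x (y i)"
    and K_separated: "\<And>i j. i \<in> I \<Longrightarrow> j \<in> I \<Longrightarrow> i \<noteq> j \<Longrightarrow> separated G (K i) (K j)"
begin

lemma insert_connected: "i \<in> I \<Longrightarrow> connected_graph (induce G (insert (y i) (K i)))"
  using connected_induce_insert K_connected y_adj by metis

lemma K_unique: "i \<in> I \<Longrightarrow> j \<in> I \<Longrightarrow> x \<in> K i \<Longrightarrow> x \<in> K j \<Longrightarrow> i = j"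
  using K_separated unfolding separated_def by blast

lemma card_K_containing: "card {i \<in> I. x \<in> K i} \<le> 1"
proof -
  have "\<exists>i. {i \<in> I. x \<in> K i} \<subseteq> {i}" using K_unique by blast
  then obtain i where "{i \<in> I. x \<in> K i} \<subseteq> {i}" by blast
  then show ?thesis using card_mono[of "{i}"] by fastforce
qed

text \<open>The branch set of \<open>u\<close> swallows the sets \<open>K i\<close> attached to \<open>u\<close> which avoid \<open>S\<close>; avoiding \<open>S\<close>
  keeps the branch sets of different elements of \<open>S\<close> disjoint.\<close>

definition branch :: "'a set \<Rightarrow> 'a \<Rightarrow> 'a set" where
  "branch S u = insert u (\<Union>i\<in>{i \<in> I. y i = u \<and> K i \<inter> S = {}}. K i)"

definition contraction :: "'a set \<Rightarrow> 'a ugraph" where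
  "contraction S = (S, {{u, v} | u v. u \<in> S \<and> v \<in> S \<and> u \<noteq> v \<and>
    (\<exists>x\<in>branch S u. \<exists>z\<in>branch S v. adj G x z)})"

lemma simple_contraction: "S \<subseteq> verts G \<Longrightarrow> simple_graph (contraction S)"
  using finite_vertex_subset by (auto simp: simple_graph_def contraction_def)

text \<open>The centre of \<open>branch S u\<close> is \<open>u\<close>. Any other vertex lies in an
  absorbed \<open>K i\<close>, and a walk without repetitions in \<open>insert u (K i)\<close> has
  at most \<open>k + 1\<close> vertices, hence at most \<open>k\<close> edges.\<close>

lemma shallow_contraction:
  assumes S: "S \<subseteq> verts G"
  shows "shallow_minor k (contraction S) G"
  unfolding shallow_minor_def
proof (intro exI[of _ "branch S"] conjI ballI impI)
  fix u assume "u \<in> verts (contraction S)"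
  then have u: "u \<in> S" by (simp add: contraction_def)
  show "branch S u \<subseteq> verts G"
    using S u K_verts by (auto simp: branch_def)
  have reach: "\<exists>p. walk (induce G (branch S u)) u p v \<and> length p \<le> Suc k" if v: "v \<in> branch S u" for v
  proof (cases "v = u")
    case True
    then show ?thesis using v by (intro exI[of _ "[u]"]) (auto simp: walk_def)
  next
    case False
    then obtain i where i: "i \<in> I" "y i = u" "K i \<inter> S = {}" "v \<in> K i"
      using v by (auto simp: branch_def)
    then have sub: "insert u (K i) \<subseteq> branch S u" by (auto simp: branch_def)
    have "(adj (induce G (insert u (K i))))\<^sup>*\<^sup>* u v"
      using insert_connected[OF i(1)] i unfolding connected_induce_iff by blast
    then obtain p where p: "walk (induce G (insert u (K i))) u p v" "distinct p"
      using rtranclp_imp_distinct_walk i(4) by (metis insertCI)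
    have "finite (K i)" using finite_vertex_subset[OF K_verts[OF i(1)]] .
    then have "length p \<le> card (insert u (K i))"
      using p card_mono[of "insert u (K i)" "set p"] by (auto simp: walk_def distinct_card)
    also have "\<dots> \<le> Suc k" using K_card[OF i(1)] \<open>finite (K i)\<close> by (simp add: card_insert_if)
    finally have "length p \<le> Suc k" .
    moreover have "walk (induce G (branch S u)) u p v"
      using p(1) sub by (auto simp: walk_def intro: successively_mono)
    ultimately show ?thesis by blast
  qed
  have uB: "u \<in> branch S u" by (simp add: branch_def)
  show "connected_graph (induce G (branch S u))"
    using uB reach walk_imp_rtranclp by (metis connected_induceI)
  show "radius_at_most (induce G (branch S u)) k"
    unfolding radius_at_most_def verts_induce
  proof (intro bexI[OF _ uB] ballI)
    fix v assume "v \<in> branch S u"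
    then obtain p where p: "walk (induce G (branch S u)) u p v" "length p \<le> Suc k"
      using reach by blast
    have "graph_dist (induce G (branch S u)) u v \<le> enat (length p - 1)"
      unfolding graph_dist_def by (rule INF_lower) (use p in simp)
    also have "\<dots> \<le> enat k" using p(2) by simp
    finally show "graph_dist (induce G (branch S u)) u v \<le> enat k" .
  qed
next
  fix u v assume "u \<in> verts (contraction S)" "v \<in> verts (contraction S)" "u \<noteq> v"
  then show "branch S u \<inter> branch S v = {}"
    using K_unique by (auto simp: contraction_def branch_def)
next
  fix u v assume "adj (contraction S) u v"
  then show "\<exists>x\<in>branch S u. \<exists>z\<in>branch S v. adj G x z"
    by (auto simp: contraction_def adj_def[of "(_, _)"] doubleton_eq_iff) (meson adj_commute)+
qed

text \<open>The pairs \<open>{y i, z}\<close> with \<open>z\<close> in or adjacent to the tree of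
  \<open>i\<close> form a sparse system. Inside \<open>S\<close> such a pair is an edge of
  \<open>contraction S\<close> or, when \<open>K i\<close> meets \<open>S\<close>, can be charged to
  an element of \<open>S\<close>.\<close>

lemma apex_coloring:
  "\<exists>f :: 'a \<Rightarrow> nat. (\<forall>v. f v < apex_colors a b k) \<and>
    (\<forall>i\<in>I. \<forall>z\<in>verts G. z \<noteq> y i \<and> f z = f (y i) \<longrightarrow> separated G {z} (insert (y i) (K i)))"
proof -
  define near where "near i = {z. z \<in> K i \<or> (\<exists>x\<in>insert (y i) (K i). adj G z x)}" for i
  define E where "E = {{y i, z} | i z. i \<in> I \<and> z \<noteq> y i \<and> z \<in> near i}"
  \<comment> \<open>Charged to \<open>p\<close> are, for \<open>p \<in> K i\<close>, the pairs of
    \<open>y i\<close> with \<open>p\<close> or with an in-neighbour of a vertex of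
    \<open>K i\<close>, and also \<open>{y i, p}\<close> whenever \<open>K i\<close> contains an
    in-neighbour of \<open>p\<close>. As the sets \<open>K i\<close> are disjoint, this makes at
    most \<open>1 + b * k\<close> and \<open>b\<close> pairs.\<close>
  define Q where "Q p = (\<Union>i\<in>{i \<in> I. p \<in> K i}. insert {y i, p} (\<Union>x\<in>K i. (\<lambda>z. {y i, z}) ` N x)) \<union>
    (\<Union>x\<in>N p. (\<lambda>i. {y i, p}) ` {i \<in> I. x \<in> K i})" for p
  have finK: "finite (K i)" if "i \<in> I" for i using finite_vertex_subset[OF K_verts[OF that]] .
  have finQ: "finite (Q p)" for p
    using finite_I finite_N finK by (auto simp: Q_def)
  have cardQ: "card (Q p) \<le> 1 + b * k + b" for p
  proof -
    have "card (insert {y i, p} (\<Union>x\<in>K i. (\<lambda>z. {y i, z}) ` N x)) \<le> 1 + b * k" if i: "i \<in> I" for i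
    proof -
      have "card (\<Union>x\<in>K i. (\<lambda>z. {y i, z}) ` N x) \<le> b * card (K i)"
        by (rule card_UN_le_mult[OF finK[OF i]])
          (use card_N finite_N in \<open>auto intro: card_image_le[THEN le_trans]\<close>)
      also have "\<dots> \<le> b * k" using K_card[OF i] by simp
      finally show ?thesis using finK[OF i] finite_N by (simp add: card_insert_if)
    qed
    then have "card (\<Union>i\<in>{i \<in> I. p \<in> K i}. insert {y i, p} (\<Union>x\<in>K i. (\<lambda>z. {y i, z}) ` N x))
        \<le> (1 + b * k) * card {i \<in> I. p \<in> K i}"
      by (intro card_UN_le_mult) (use finite_I in auto)
    also have "\<dots> \<le> (1 + b * k) * 1" by (rule mult_le_mono2[OF card_K_containing])
    finally have 1: "card (\<Union>i\<in>{i \<in> I. p \<in> K i}. insert {y i, p} (\<Union>x\<in>K i. (\<lambda>z. {y i, z}) ` N x))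
        \<le> 1 + b * k" by simp
    have "card (\<Union>x\<in>N p. (\<lambda>i. {y i, p}) ` {i \<in> I. x \<in> K i}) \<le> 1 * card (N p)"
      by (rule card_UN_le_mult[OF finite_N])
        (use card_K_containing finite_I in \<open>auto intro: card_image_le[THEN le_trans]\<close>)
    then have 2: "card (\<Union>x\<in>N p. (\<lambda>i. {y i, p}) ` {i \<in> I. x \<in> K i}) \<le> b"
      using card_N[of p] by simp
    show ?thesis unfolding Q_def using card_Un_le 1 2 by (meson add_mono le_trans)
  qed
  have "sparse (a + (1 + b * k + b)) (verts G) E"
  proof (rule sparseI)
    show "finite (verts G)" using simple by (simp add: simple_graph_def)
  next
    fix S assume S: "S \<subseteq> verts G"
    have "{e \<in> E. e \<subseteq> S} \<subseteq> edges (contraction S) \<union> (\<Union>p\<in>S. Q p)"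
    proof
      fix e assume "e \<in> {e \<in> E. e \<subseteq> S}"
      then obtain i z where e: "e = {y i, z}" "y i \<in> S" "z \<in> S" and i: "i \<in> I" "z \<noteq> y i" "z \<in> near i"
        by (auto simp: E_def)
      have yz: "y i \<in> branch S (y i)" "z \<in> branch S z" by (auto simp: branch_def)
      consider "z \<in> K i" | "adj G z (y i)" | x where "x \<in> K i" "adj G z x"
        using i(3) by (auto simp: near_def)
      then show "e \<in> edges (contraction S) \<union> (\<Union>p\<in>S. Q p)"
      proof cases
        case 1
        then show ?thesis using e i by (auto simp: Q_def)
      next
        case 2
        then have "e \<in> edges (contraction S)"
          using e i(2) yz unfolding contraction_def by (auto simp: adj_commute)
        then show ?thesis by blast
      next
        case 3
        show ?thesis
        proof (cases "K i \<inter> S = {}")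
          case True
          then have "x \<in> branch S (y i)" using 3 i(1) by (auto simp: branch_def)
          then have "e \<in> edges (contraction S)"
            using e i(2) yz 3 unfolding contraction_def by (auto simp: adj_commute)
          then show ?thesis by blast
        next
          case False
          then obtain p where p: "p \<in> K i" "p \<in> S" by blast
          \<comment> \<open>The orientation decides who pays: \<open>z \<in> N x\<close> charges
            \<open>p\<close>, and \<open>x \<in> N z\<close> charges \<open>z\<close>.\<close>
          from orientation[OF 3(2)] have "e \<in> Q p \<or> e \<in> Q z"
            using p(1) 3(1) e(1) i(1) unfolding Q_def by blast
          then show ?thesis using p(2) e(3) by blast
        qed
      qed
    qed
    moreover have "finite (edges (contraction S))"
      by (rule simple_graph_finite_edges[OF simple_contraction[OF S]])
    moreover have "card (edges (contraction S)) \<le> a * card S"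
      using density[OF simple_contraction[OF S] shallow_contraction[OF S]]
      by (simp add: contraction_def)
    ultimately show "\<exists>A Q. {e \<in> E. e \<subseteq> S} \<subseteq> A \<union> (\<Union>v\<in>S. Q v) \<and> finite A \<and> card A \<le> a * card S \<and>
        (\<forall>v\<in>S. finite (Q v) \<and> card (Q v) \<le> 1 + b * k + b)"
      using finQ cardQ by (intro exI[of _ "edges (contraction S)"] exI[of _ Q]) simp
  qed
  then obtain f :: "'a \<Rightarrow> nat" where f: "\<And>v. f v \<le> 2 * (a + (1 + b * k + b))"
    and proper: "\<And>u v. u \<in> verts G \<Longrightarrow> v \<in> verts G \<Longrightarrow> u \<noteq> v \<Longrightarrow> {u, v} \<in> E \<Longrightarrow> f u \<noteq> f v"
    using sparse_coloring simple unfolding simple_graph_def by metis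
  have "separated G {z} (insert (y i) (K i))"
    if z: "i \<in> I" "z \<in> verts G" "z \<noteq> y i" "f z = f (y i)" for i z
  proof -
    have "{y i, z} \<notin> E" using proper[of "y i" z] y_verts z by auto
    then have "z \<notin> near i" using z by (auto simp: E_def)
    then show ?thesis using z(3) by (auto simp: separated_def near_def)
  qed
  then show ?thesis using f by (intro exI[of _ f]) (auto simp: apex_colors_def less_Suc_eq_le)
qed

text \<open>For each apex colour, the trees with popular apexes of this colour form one strong
  forest. It is acyclic by \<open>acyclic_glue\<close>, and its components are large because the
  trees at a common apex hang together and each contributes an edge at that apex.\<close>

lemma popular_apex_cover:
  assumes I_edges: "\<And>i. i \<in> I \<Longrightarrow> edge i \<in> edges G \<and> edge i \<subseteq> insert (y i) (K i)"
    and acy: "\<And>i. i \<in> I \<Longrightarrow> acyclic_graph (induce G (insert (y i) (K i)))"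
  shows "forest_cover G k (apex_colors a b k) (edge ` {i \<in> I. k \<le> card {j \<in> I. y j = y i}})"
proof -
  obtain f :: "'a \<Rightarrow> nat" where f: "\<And>v. f v < apex_colors a b k"
    and sep: "\<And>i z. i \<in> I \<Longrightarrow> z \<in> verts G \<Longrightarrow> z \<noteq> y i \<Longrightarrow> f z = f (y i) \<Longrightarrow>
      separated G {z} (insert (y i) (K i))"
    using apex_coloring by metis
  define J where "J c = {i \<in> I. f (y i) = c \<and> k \<le> card {j \<in> I. y j = y i}}" for c
  have "forest_cover G k 1 (edge ` J c)" for c
  proof (rule forest_cover_single)
    let ?U = "\<Union>i\<in>J c. K i \<union> {y i}"
    have JI: "i \<in> I" if "i \<in> J c" for i using that by (simp add: J_def)
    have sepJ: "separated G {y i} (insert (y j) (K j))" if "i \<in> J c" "j \<in> J c" "y i \<noteq> y j" for i j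
      using sep[of j "y i"] that y_verts by (auto simp: J_def)
    show "strong_forest k G (induce G ?U)"
    proof (rule strong_forestI[OF simple])
      show "?U \<subseteq> verts G" using K_verts y_verts JI by blast
      show "acyclic_graph (induce G ?U)"
      proof (rule acyclic_glue[where y = y])
        show "acyclic_graph (induce G (K i \<union> {y i}))" if "i \<in> J c" for i
          using acy JI that by simp
        show "i = j" if "i \<in> J c" "j \<in> J c" "u \<in> K i" "v \<in> K j" "adj G u v" for i j u v
          using K_separated[of i j] JI that unfolding separated_def by blast
        show "u \<in> {y j}" if "i \<in> J c" "j \<in> J c" "u \<in> {y i}" "v \<in> K j" "adj G u v" for i j u v
          using sepJ[of i j] that unfolding separated_def by blast
        show "\<not> adj G u v" if "i \<in> J c" "j \<in> J c" "u \<in> {y i}" "v \<in> {y j}" for i j u v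
          using sepJ[of i j] that adj_simple(3)[OF simple, of u v] unfolding separated_def by blast
      qed (use simple in auto)
    next
      fix x assume "x \<in> ?U"
      then obtain i where i: "i \<in> J c" "x \<in> insert (y i) (K i)" by blast
      let ?L = "{j \<in> I. y j = y i}"
      let ?Z = "\<Union>j\<in>?L. insert (y j) (K j)"
      \<comment> \<open>For members of \<open>I\<close>, lying in \<open>J c\<close> depends only on
        the apex, so everything that shares the apex of \<open>i\<close> lies in \<open>J c\<close>
        as well.\<close>
      have L: "?L \<subseteq> J c" "i \<in> ?L" using i(1) by (auto simp: J_def)
      have "\<forall>j\<in>?L. \<exists>x. x \<in> K j \<and> adj G x (y i)" using y_adj by fastforce
      then obtain g where g: "\<And>j. j \<in> ?L \<Longrightarrow> g j \<in> K j \<and> adj G (g j) (y i)" by metis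
      have "k \<le> card ?L" using i(1) by (simp add: J_def)
      also have "\<dots> = card ((\<lambda>j. {g j, y i}) ` ?L)"
      \<comment> \<open>The edges at the common apex differ because their other ends lie in disjoint
        sets.\<close>
      proof (rule card_image[symmetric], rule inj_onI)
        fix j l assume jl: "j \<in> ?L" "l \<in> ?L" "{g j, y i} = {g l, y i}"
        then have "g j = g l" by (auto simp: doubleton_eq_iff)
        then show "j = l" using K_unique g jl by (metis (no_types, lifting) mem_Collect_eq)
      qed
      also have "\<dots> \<le> card (edges (induce G ?Z))"
      proof (rule card_mono)
        show "finite (edges (induce G ?Z))" using simple_graph_finite_edges[OF simple] by simp
        show "(\<lambda>j. {g j, y i}) ` ?L \<subseteq> edges (induce G ?Z)"
          using g by (auto simp: adj_def)
      qed
      finally have "k \<le> card (edges (induce G ?Z))" .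
      moreover have "connected_graph (induce G ?Z)"
      proof (rule connected_induce_Union[where c = "y i"])
        show "connected_graph (induce G (insert (y j) (K j)))" if "j \<in> ?L" for j
          using insert_connected that by blast
      qed (use L in auto)
      moreover have "x \<in> ?Z" "?Z \<subseteq> ?U" using i(2) L by auto
      ultimately show "\<exists>Z\<subseteq>?U. x \<in> Z \<and> connected_graph (induce G Z) \<and> k \<le> card (edges (induce G Z))"
        by blast
    qed
    have "edge i \<in> edges (induce G ?U)" if "i \<in> J c" for i
      using I_edges[OF JI[OF that]] that by auto
    then show "edge ` J c \<subseteq> edges (induce G ?U)" by blast
  qed
  then have "forest_cover G k (apex_colors a b k * 1) (edge ` {i \<in> I. k \<le> card {j \<in> I. y j = y i}})"
    by (rule forest_cover_UN[where X = "\<lambda>c. edge ` J c"]) (use f in \<open>auto simp: J_def\<close>)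
  then show ?thesis by simp
qed

end

section \<open>Growing the trees\<close>

context sparse_graph
begin

text \<open>Final stage: the trees have \<open>k\<close> edges themselves, so the separated trees of
  one conflict colour already form a strong forest.\<close>

lemma separated_forest_cover:
  assumes fin: "finite I" and K: "\<And>i. i \<in> I \<Longrightarrow> K i \<subseteq> verts G" "\<And>i. i \<in> I \<Longrightarrow> card (K i) \<le> Suc k"
    and m: "\<And>x. card {i \<in> I. x \<in> K i} \<le> m"
    and tree: "\<And>i. i \<in> I \<Longrightarrow> connected_graph (induce G (K i))"
      "\<And>i. i \<in> I \<Longrightarrow> acyclic_graph (induce G (K i))"
      "\<And>i. i \<in> I \<Longrightarrow> k \<le> card (edges (induce G (K i)))"
    and edge: "\<And>i. i \<in> I \<Longrightarrow> edge i \<in> edges G \<and> edge i \<subseteq> K i"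
  shows "forest_cover G k (conflict_colors b k m) (edge ` I)"
proof -
  obtain f :: "'b \<Rightarrow> nat" where f: "\<And>i. f i < conflict_colors b k m"
    and sep: "\<And>i j. i \<in> I \<Longrightarrow> j \<in> I \<Longrightarrow> i \<noteq> j \<Longrightarrow> f i = f j \<Longrightarrow> separated G (K i) (K j)"
    using conflict_coloring[where K = K, OF fin K m] by metis
  define J where "J c = {i \<in> I. f i = c}" for c
  have "forest_cover G k 1 (edge ` J c)" for c
  proof (rule forest_cover_single)
    \<comment> \<open>The empty set stands for \<open>Y i\<close> and gives the union the shape
      required by \<open>acyclic_glue\<close>.\<close>
    let ?U = "\<Union>i\<in>J c. K i \<union> {}"
    show "strong_forest k G (induce G ?U)"
    proof (rule strong_forestI[OF simple])
      show "?U \<subseteq> verts G" using K(1) by (auto simp: J_def)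
      show "acyclic_graph (induce G ?U)"
      proof (rule acyclic_glue)
        show "i = j" if "i \<in> J c" "j \<in> J c" "u \<in> K i" "v \<in> K j" "adj G u v" for i j u v
          using sep[of i j] that unfolding separated_def J_def by auto
      qed (use simple tree(2) in \<open>auto simp: J_def\<close>)
    next
      fix x assume "x \<in> ?U"
      then obtain i where "i \<in> J c" "x \<in> K i" by blast
      then show "\<exists>Z\<subseteq>?U. x \<in> Z \<and> connected_graph (induce G Z) \<and> k \<le> card (edges (induce G Z))"
        using tree(1,3) by (intro exI[of _ "K i"]) (auto simp: J_def)
    qed
    show "edge ` J c \<subseteq> edges (induce G ?U)" using edge by (fastforce simp: J_def)
  qed
  then have "forest_cover G k (conflict_colors b k m * 1) (edge ` I)"
    by (rule forest_cover_UN[where X = "\<lambda>c. edge ` J c"]) (use f in \<open>auto simp: J_def\<close>)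
  then show ?thesis by simp
qed

text \<open>Apexes \<open>y i\<close> shared by many members of a colour class yield large components at once, so the
  members that are left over share each apex with boundedly many others.\<close>

lemma extension_step:
  assumes fin: "finite I" and K: "\<And>i. i \<in> I \<Longrightarrow> K i \<subseteq> verts G" "\<And>i. i \<in> I \<Longrightarrow> card (K i) \<le> k"
    and m: "\<And>x. card {i \<in> I. x \<in> K i} \<le> m"
    and conn: "\<And>i. i \<in> I \<Longrightarrow> connected_graph (induce G (K i))"
    and y: "\<And>i. i \<in> I \<Longrightarrow> y i \<in> verts G - K i" "\<And>i. i \<in> I \<Longrightarrow> \<exists>x\<in>K i. adj G x (y i)"
    and acy: "\<And>i. i \<in> I \<Longrightarrow> acyclic_graph (induce G (insert (y i) (K i)))"
    and edge: "\<And>i. i \<in> I \<Longrightarrow> edge i \<in> edges G \<and> edge i \<subseteq> insert (y i) (K i)"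
  shows "\<exists>J\<subseteq>I. forest_cover G k (conflict_colors b k m * apex_colors a b k) (edge ` (I - J)) \<and>
    (\<forall>x. card {i \<in> J. x \<in> insert (y i) (K i)} \<le> conflict_colors b k m * k + m)"
proof -
  have "\<And>i. i \<in> I \<Longrightarrow> card (K i) \<le> Suc k" using K(2) le_SucI by blast
  then obtain f :: "'b \<Rightarrow> nat" where f: "\<And>i. f i < conflict_colors b k m"
    and sep: "\<And>i j. i \<in> I \<Longrightarrow> j \<in> I \<Longrightarrow> i \<noteq> j \<Longrightarrow> f i = f j \<Longrightarrow> separated G (K i) (K j)"
    using conflict_coloring[where K = K, OF fin K(1) _ m] by metis
  \<comment> \<open>\<open>J\<close> keeps the members whose apex is shared by fewer than
    \<open>k\<close> members of their colour class; \<open>popular_apex_cover\<close>, applied to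
    each class, covers the others.\<close>
  define J where "J = {i \<in> I. card {j \<in> I. f j = f i \<and> y j = y i} < k}"
  have "forest_cover G k (apex_colors a b k)
      (edge ` {i \<in> {i \<in> I. f i = c}. k \<le> card {j \<in> {i \<in> I. f i = c}. y j = y i}})" for c
  proof -
    interpret separated_family G N a b k "{i \<in> I. f i = c}" K y
      by unfold_locales (use fin K conn y sep in auto)
    show ?thesis by (rule popular_apex_cover) (use edge acy in auto)
  qed
  then have "forest_cover G k (conflict_colors b k m * apex_colors a b k) (edge ` (I - J))"
    by (rule forest_cover_UN) (use f in \<open>fastforce simp: J_def not_less conj_assoc\<close>)
  moreover have "card {i \<in> J. x \<in> insert (y i) (K i)} \<le> conflict_colors b k m * k + m" for x
  proof -
    \<comment> \<open>Unpopularity bounds, colour by colour, the members that acquire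
      \<open>x\<close> as their apex. Those that contained \<open>x\<close> before account for the
      summand \<open>m\<close>.\<close>
    have "card {i \<in> J. y i = x \<and> f i = c} \<le> k" for c
    proof (cases "{i \<in> J. y i = x \<and> f i = c} = {}")
      case True
      show ?thesis unfolding True by simp
    next
      case False
      then obtain i where i: "i \<in> J" "y i = x" "f i = c" by blast
      have "card {i \<in> J. y i = x \<and> f i = c} \<le> card {j \<in> I. f j = f i \<and> y j = y i}"
        by (rule card_mono) (use fin i in \<open>auto simp: J_def\<close>)
      also have "\<dots> \<le> k" using i(1) by (simp add: J_def)
      finally show ?thesis .
    qed
    then have "card (\<Union>c<conflict_colors b k m. {i \<in> J. y i = x \<and> f i = c}) \<le> k * card {..<conflict_colors b k m}"
      by (intro card_UN_le_mult) auto
    then have 1: "card (\<Union>c<conflict_colors b k m. {i \<in> J. y i = x \<and> f i = c}) \<le> conflict_colors b k m * k"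
      by (simp add: mult.commute)
    have finJ: "finite J" using fin by (simp add: J_def)
    have "card {i \<in> J. x \<in> insert (y i) (K i)} \<le>
        card ((\<Union>c<conflict_colors b k m. {i \<in> J. y i = x \<and> f i = c}) \<union> {i \<in> I. x \<in> K i})"
      by (rule card_mono) (use f fin finJ in \<open>auto simp: J_def\<close>)
    then show ?thesis using card_Un_le add_mono[OF 1 m[of x]] le_trans by blast
  qed
  moreover have "J \<subseteq> I" by (auto simp: J_def)
  ultimately show ?thesis by blast
qed

text \<open>Induction on the number \<open>j\<close> of missing vertices, the trees being indexed by
  the edges themselves. A set with fewer than \<open>k\<close> edges is a proper subtree of
  \<open>T\<close>, so a vertex of \<open>T\<close> can be attached to it, by exactly one edge.
  \<open>extension_step\<close> covers some edges and leaves the rest to the induction hypothesis,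
  with a larger overlap bound.\<close>

lemma growing_cover:
  assumes "finite I" and "\<And>x. card {i \<in> I. x \<in> K i} \<le> m"
    and "\<And>i. i \<in> I \<Longrightarrow> i \<in> edges G \<and> i \<subseteq> K i"
    and "\<And>i. i \<in> I \<Longrightarrow> connected_graph (induce G (K i))"
    and "\<And>i. i \<in> I \<Longrightarrow> card (K i) + j = Suc k"
    and "\<And>i. i \<in> I \<Longrightarrow> Suc (card (edges (induce G (K i)))) = card (K i)"
    and "\<And>i. i \<in> I \<Longrightarrow> \<exists>T\<subseteq>verts G. K i \<subseteq> T \<and> connected_graph (induce G T) \<and>
      acyclic_graph (induce G T) \<and> k \<le> card (edges (induce G T))"
  shows "forest_cover G k (cover_bound a b k j m) I"
  using assms
proof (induction j arbitrary: I K m)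
  case 0
  have "forest_cover G k (conflict_colors b k m) ((\<lambda>i. i) ` I)"
  proof (rule separated_forest_cover[where K = K])
    fix i assume i: "i \<in> I"
    obtain T where T: "T \<subseteq> verts G" "K i \<subseteq> T" "acyclic_graph (induce G T)"
      using "0.prems"(7)[OF i] by blast
    then show "K i \<subseteq> verts G" by blast
    show "acyclic_graph (induce G (K i))" by (rule acyclic_induce_subset[OF T(3,2)])
    show "k \<le> card (edges (induce G (K i)))" "card (K i) \<le> Suc k"
      using "0.prems"(5,6)[OF i] by linarith+
  qed (use "0.prems" in auto)
  then show ?case by simp
next
  case (Suc j)
  have "\<exists>y. \<exists>x\<in>K i. y \<in> verts G - K i \<and> adj G x y \<and> acyclic_graph (induce G (insert y (K i))) \<and>
      Suc (card (edges (induce G (insert y (K i))))) = card (insert y (K i)) \<and>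
      (\<exists>T\<subseteq>verts G. insert y (K i) \<subseteq> T \<and> connected_graph (induce G T) \<and>
        acyclic_graph (induce G T) \<and> k \<le> card (edges (induce G T)))" if i: "i \<in> I" for i
  proof -
    obtain T where T: "T \<subseteq> verts G" "K i \<subseteq> T" "connected_graph (induce G T)"
      "acyclic_graph (induce G T)" "k \<le> card (edges (induce G T))"
      using Suc.prems(7)[OF i] by blast
    have conn: "connected_graph (induce G (K i))" by (rule Suc.prems(4)[OF i])
    then have ne: "K i \<noteq> {}" by (simp add: connected_induce_iff)
    have "card (edges (induce G (K i))) < k" using Suc.prems(5,6)[OF i] by linarith
    then have "K i \<subset> T" using T(2,5) by fastforce
    then obtain x y where xy: "x \<in> K i" "y \<in> T - K i" "adj G x y"
      using connected_crossing_edge[OF T(3) _ ne] by blast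
    have "x' = x" if "x' \<in> K i" "adj G x' y" for x'
      using acyclic_unique_neighbour[OF T(4) conn T(2) xy(2) that xy(1,3)] .
    then have "card (edges (induce G (insert y (K i)))) = Suc (card (edges (induce G (K i))))"
      using card_edges_insert[OF simple _ xy(1,3)] xy(2) by blast
    moreover have "finite (K i)" using finite_vertex_subset T(1,2) by blast
    moreover have "insert y (K i) \<subseteq> T" using xy T(2) by blast
    moreover have "acyclic_graph (induce G (insert y (K i)))"
      using acyclic_induce_subset[OF T(4)] xy T(2) by blast
    ultimately show ?thesis
      using xy T Suc.prems(6)[OF i]
      by (intro exI[of _ y] bexI[of _ x] conjI exI[of _ T]) auto
  qed
  then obtain y where y: "\<And>i. i \<in> I \<Longrightarrow> \<exists>x\<in>K i. y i \<in> verts G - K i \<and> adj G x (y i) \<and>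
      acyclic_graph (induce G (insert (y i) (K i))) \<and>
      Suc (card (edges (induce G (insert (y i) (K i))))) = card (insert (y i) (K i)) \<and>
      (\<exists>T\<subseteq>verts G. insert (y i) (K i) \<subseteq> T \<and> connected_graph (induce G T) \<and>
        acyclic_graph (induce G T) \<and> k \<le> card (edges (induce G T)))"
    by metis
  have Kv: "K i \<subseteq> verts G" if "i \<in> I" for i using Suc.prems(7)[OF that] by blast
  have "\<exists>J\<subseteq>I. forest_cover G k (conflict_colors b k m * apex_colors a b k) ((\<lambda>i. i) ` (I - J)) \<and>
      (\<forall>x. card {i \<in> J. x \<in> insert (y i) (K i)} \<le> conflict_colors b k m * k + m)"
  proof (rule extension_step)
    show "card (K i) \<le> k" if "i \<in> I" for i using Suc.prems(5)[OF that] by simp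
    show "y i \<in> verts G - K i" "\<exists>x\<in>K i. adj G x (y i)"
      "acyclic_graph (induce G (insert (y i) (K i)))" if "i \<in> I" for i
      using y[OF that] by blast+
    show "i \<in> edges G \<and> i \<subseteq> insert (y i) (K i)" if "i \<in> I" for i using Suc.prems(3)[OF that] by blast
  qed (use Suc.prems(1,2,4) Kv in auto)
  then obtain J where J: "J \<subseteq> I"
    "forest_cover G k (conflict_colors b k m * apex_colors a b k) (I - J)"
    "\<And>x. card {i \<in> J. x \<in> insert (y i) (K i)} \<le> conflict_colors b k m * k + m"
    by auto
  have "forest_cover G k (cover_bound a b k j (conflict_colors b k m * k + m)) J"
  proof (rule Suc.IH[where K = "\<lambda>i. insert (y i) (K i)"])
    show "finite J" using J(1) Suc.prems(1) finite_subset by blast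
    fix i assume "i \<in> J"
    then have i: "i \<in> I" using J(1) by blast
    show "i \<in> edges G \<and> i \<subseteq> insert (y i) (K i)" using Suc.prems(3)[OF i] by blast
    show "connected_graph (induce G (insert (y i) (K i)))"
      using y[OF i] connected_induce_insert[OF Suc.prems(4)[OF i]] by blast
    show "Suc (card (edges (induce G (insert (y i) (K i))))) = card (insert (y i) (K i))"
      "\<exists>T\<subseteq>verts G. insert (y i) (K i) \<subseteq> T \<and> connected_graph (induce G T) \<and>
        acyclic_graph (induce G T) \<and> k \<le> card (edges (induce G T))"
      using y[OF i] by blast+
    show "card (insert (y i) (K i)) + j = Suc k"
      using y[OF i] finite_vertex_subset[OF Kv[OF i]] Suc.prems(5)[OF i] by auto
  qed (rule J(3))
  then have "forest_cover G k (cover_bound a b k (Suc j) m) ((I - J) \<union> J)"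
    unfolding cover_bound.simps by (rule forest_cover_Un[OF J(2)])
  moreover have "(I - J) \<union> J = I" using J(1) by blast
  ultimately show ?case by simp
qed

text \<open>Each valid edge starts as the tree \<open>{v e}\<close> with apex
  \<open>w e \<in> N (v e)\<close>. At most \<open>b\<close> edges start at a given vertex, being
  determined by an element of its \<open>N\<close>; hence the initial overlap \<open>b\<close>. As
  \<open>{v e}\<close> does not yet contain \<open>e\<close>, this first extension precedes
  \<open>growing_cover\<close>.\<close>

lemma valid_edges_cover:
  assumes k: "1 \<le> k"
  shows "forest_cover G k (cover_bound a b k k b) {e. valid_edge k G e}"
proof -
  let ?I = "{e. valid_edge k G e}"
  have fin: "finite ?I"
    by (rule finite_subset[OF _ simple_graph_finite_edges[OF simple]]) (auto simp: valid_edge_def)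
  have "\<exists>v w. e = {v, w} \<and> w \<in> N v \<and> adj G v w" if "e \<in> ?I" for e
  proof -
    have e: "e \<in> edges G" using that by (simp add: valid_edge_def)
    then obtain u v where uv: "e = {u, v}" using simple by (auto simp: simple_graph_def)
    then have "adj G u v" "adj G v u" using e by (auto simp: adj_def insert_commute)
    then show ?thesis using orientation[of u v] uv by (metis insert_commute)
  qed
  then obtain v w where vw: "\<And>e. e \<in> ?I \<Longrightarrow> e = {v e, w e} \<and> w e \<in> N (v e) \<and> adj G (v e) (w e)"
    by metis
  note vw_simple = adj_simple[OF simple, of "v e" "w e" for e]
  \<comment> \<open>A single vertex lacks \<open>k\<close> vertices; attaching \<open>w e\<close>
    leaves \<open>j\<close> to be added.\<close>
  obtain j where j: "k = Suc j" using k by (cases k) auto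
  have "\<exists>J\<subseteq>?I. forest_cover G k (conflict_colors b k b * apex_colors a b k) ((\<lambda>i. i) ` (?I - J)) \<and>
      (\<forall>x. card {i \<in> J. x \<in> insert (w i) {v i}} \<le> conflict_colors b k b * k + b)"
  proof (rule extension_step)
    show "card {e \<in> ?I. x \<in> {v e}} \<le> b" for x
    proof -
      have "{e \<in> ?I. x \<in> {v e}} \<subseteq> (\<lambda>z. {x, z}) ` N x" using vw by blast
      then have "card {e \<in> ?I. x \<in> {v e}} \<le> card ((\<lambda>z. {x, z}) ` N x)"
        by (intro card_mono) (use finite_N in auto)
      also have "\<dots> \<le> b" using card_image_le[OF finite_N] card_N le_trans by blast
      finally show ?thesis .
    qed
    fix e assume e: "e \<in> ?I"
    show "acyclic_graph (induce G (insert (w e) {v e}))"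
      by (rule acyclic_induce_small) (auto simp: card_insert_if)
    show "e \<in> edges G \<and> e \<subseteq> insert (w e) {v e}" using vw[OF e] e by (auto simp: valid_edge_def)
    show "{v e} \<subseteq> verts G" "w e \<in> verts G - {v e}" "\<exists>x\<in>{v e}. adj G x (w e)"
      using vw[OF e] vw_simple[of e] by auto
    show "connected_graph (induce G {v e})" by (rule connected_induce_singleton)
  qed (use fin k in auto)
  then obtain J where J: "J \<subseteq> ?I"
    "forest_cover G k (conflict_colors b k b * apex_colors a b k) (?I - J)"
    "\<And>x. card {i \<in> J. x \<in> insert (w i) {v i}} \<le> conflict_colors b k b * k + b"
    by auto
  have "forest_cover G k (cover_bound a b k j (conflict_colors b k b * k + b)) J"
  proof (rule growing_cover[where K = "\<lambda>e. insert (w e) {v e}"])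
    show "finite J" using J(1) fin finite_subset by blast
    fix e assume "e \<in> J"
    then have e: "e \<in> ?I" using J(1) by blast
    note e' = vw[OF e]
    then have ne: "v e \<noteq> w e" using vw_simple by blast
    show "e \<in> edges G \<and> e \<subseteq> insert (w e) {v e}" using e e' by (auto simp: valid_edge_def)
    show "connected_graph (induce G (insert (w e) {v e}))"
      by (rule connected_induce_insert[OF connected_induce_singleton]) (use e' in auto)
    show "card (insert (w e) {v e}) + j = Suc k" using ne j by simp
    have "edges (induce G {v e}) = {}"
    proof -
      have "\<not> x \<subseteq> {v e}" if "x \<in> edges G" for x
        using simple that unfolding simple_graph_def by fastforce
      then show ?thesis by auto
    qed
    then show "Suc (card (edges (induce G (insert (w e) {v e})))) = card (insert (w e) {v e})"
      using card_edges_insert[OF simple, of "w e" "{v e}" "v e"] e' ne by simp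
    show "\<exists>T\<subseteq>verts G. insert (w e) {v e} \<subseteq> T \<and> connected_graph (induce G T) \<and>
        acyclic_graph (induce G T) \<and> k \<le> card (edges (induce G T))"
      using valid_edge_tree[OF simple, of k e] e e' by (metis insert_commute mem_Collect_eq)
  qed (rule J(3))
  then have "forest_cover G k (cover_bound a b k (Suc j) b) ((?I - J) \<union> J)"
    unfolding cover_bound.simps by (rule forest_cover_Un[OF J(2)])
  moreover have "(?I - J) \<union> J = ?I" using J(1) by blast
  ultimately show ?thesis using j by simp
qed

end

section \<open>Classes of bounded expansion\<close>

lemma strong_arboricity_le:
  assumes "forest_cover G k c {e. valid_edge k G e}"
  shows "strong_arboricity k G \<le> c"
proof -
  obtain \<F> where "strong_cover k G \<F>" "card \<F> \<le> c"
    using assms unfolding forest_cover_def strong_cover_def by blast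
  moreover from this have "strong_arboricity k G \<le> card \<F>"
    unfolding strong_arboricity_def by (intro Least_le) blast
  ultimately show ?thesis by simp
qed

text \<open>Singletons serve as branch sets. The density bound for minors thereby applies to the
  induced subgraphs of \<open>G\<close>, so its edge set is sparse and can be oriented.\<close>

lemma shallow_minor_induce:
  assumes "S \<subseteq> verts G"
  shows "shallow_minor d (induce G S) G"
  unfolding shallow_minor_def
proof (intro exI[of _ "\<lambda>v. {v}"] conjI ballI impI)
  fix v assume "v \<in> verts (induce G S)"
  then show "{v} \<subseteq> verts G" using assms by auto
  show "connected_graph (induce G {v})" by (rule connected_induce_singleton)
  have "graph_dist (induce G {v}) v v \<le> enat (length [v] - 1)"
    unfolding graph_dist_def by (rule INF_lower) (simp add: walk_def)
  then show "radius_at_most (induce G {v}) d"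
    by (auto simp: radius_at_most_def zero_enat_def[symmetric])
qed auto

lemma simple_induce: "simple_graph G \<Longrightarrow> S \<subseteq> verts G \<Longrightarrow> simple_graph (induce G S)"
  unfolding simple_graph_def verts_induce edges_induce
  by (metis (no_types, lifting) finite_subset insert_subset mem_Collect_eq)

theorem theorem1:
  fixes \<C> :: "'a ugraph set"
  assumes "\<And>G. G \<in> \<C> \<Longrightarrow> simple_graph G"
    and "bounded_expansion \<C>"
  shows "\<forall>k\<ge>1. \<exists>c :: nat. \<forall>G\<in>\<C>. strong_arboricity k G \<le> c"
proof (intro allI impI)
  fix k :: nat assume k: "1 \<le> k"
  obtain r :: real where r: "\<And>G H. G \<in> \<C> \<Longrightarrow> simple_graph (H :: 'a ugraph) \<Longrightarrow> shallow_minor k H G \<Longrightarrow>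
      real (card (edges H)) \<le> r * real (card (verts H))"
    using bounded_expansion_any_type[OF assms(2), of k] by blast
  \<comment> \<open>The bound \<open>r\<close> may be fractional or negative; this is a natural
    number above it.\<close>
  define a where "a = nat \<lceil>r\<rceil>"
  have density: "card (edges H) \<le> a * card (verts H)"
    if "G \<in> \<C>" "simple_graph H" "shallow_minor k H G" for G and H :: "'a ugraph"
  proof -
    have "r \<le> real a" unfolding a_def by linarith
    then have "r * real (card (verts H)) \<le> real a * real (card (verts H))"
      by (rule mult_right_mono) simp
    then have "real (card (edges H)) \<le> real (a * card (verts H))" using r[OF that] by simp
    then show ?thesis by (simp only: of_nat_le_iff)
  qed
  \<comment> \<open>Orienting an edge set of sparseness \<open>a\<close> gives in-neighbourhoods of
    size at most \<open>2 * a\<close>, which is both \<open>b\<close> and the initial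
    overlap.\<close>
  have "strong_arboricity k G \<le> cover_bound a (2 * a) k k (2 * a)" if G: "G \<in> \<C>" for G
  proof -
    have sG: "simple_graph G" by (rule assms(1)[OF G])
    have "sparse a (verts G) (edges G)"
      unfolding sparse_def
      using density[OF G simple_induce[OF sG] shallow_minor_induce] simple_graph_finite_edges[OF sG]
      by auto
    then obtain N where N: "\<And>v. finite (N v) \<and> card (N v) \<le> 2 * a"
      "\<And>u v. u \<in> verts G \<Longrightarrow> v \<in> verts G \<Longrightarrow> u \<noteq> v \<Longrightarrow> {u, v} \<in> edges G \<Longrightarrow> u \<in> N v \<or> v \<in> N u"
      using sparse_orientation sG unfolding simple_graph_def by metis
    interpret sparse_graph G N a "2 * a" k
    proof unfold_locales
      show "u \<in> N v \<or> v \<in> N u" if "adj G u v" for u v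
        using N(2) adj_simple[OF sG that] that unfolding adj_def by blast
    qed (use sG N(1) density[OF G] in auto)
    show ?thesis by (rule strong_arboricity_le[OF valid_edges_cover[OF k]])
  qed
  then show "\<exists>c :: nat. \<forall>G\<in>\<C>. strong_arboricity k G \<le> c" by blast
qed

end
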